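(* Let $E$ be an arbitrary subset of $\mathbb{R}^n$ and let $f:E\to\mathbb{R}$, $G:E\to\mathbb{R}^n$ be two functions. Suppose that $\mathrm{span}\{G(x)-G(y) : x,y\in E\}=\mathbb{R}^n$. Then there exists a convex function $F:\mathbb{R}^n\to\mathbb{R}$ of class $C^1$ with $F(x)=f(x)$ and $\nabla F(x)=G(x)$ for all $x\in E$ if and only if the following conditions are satisfied: (i) $G$ is continuous and $f(x)\geq f(y)+\langle G(y),x-y\rangle$ for all $x,y\in E$. (ii) If $(x_k)_k\subset E$ is a sequence for which $\lim_{k\to\infty}|G(x_k)|=+\infty$, then $$\lim_{k\to\infty}\frac{\langle G(x_k),x_k\rangle-f(x_k)}{|G(x_k)|}=+\infty.$$ (iii) If $(x_k)_k,(z_k)_k$ are sequences in $E$ such that $(x_k)_k$ and $(G(z_k))_k$ are bounded, and $$\lim_{k\to\infty}\left(f(x_k)-f(z_k)-\langle G(z_k),x_k-z_k\rangle\right)=0,$$ then $\lim_{k\to\infty}|G(x_k)-G(z_k)|=0$. Moreover, whenever these conditions are satisfied, the extension $F$ can be taken to be essentially coercive.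
   Context: $\langle\cdot,\cdot\rangle$ and $|\cdot|$ denote the Euclidean inner product and norm on $\mathbb{R}^n$. A function $F:\mathbb{R}^n\to\mathbb{R}$ is called essentially coercive if there exists a linear function $\ell:\mathbb{R}^n\to\mathbb{R}$ such that $\lim_{|x|\to\infty}(F(x)-\ell(x))=\infty$. *)

theory Defs
  imports "HOL-Analysis.Analysis"
begin

definition class_C1 :: "('a::euclidean_space \<Rightarrow> real) \<Rightarrow> bool" where
  "class_C1 F \<longleftrightarrow> (\<exists>g. continuous_on UNIV g \<and> (\<forall>x. GDERIV F x :> g x))"

definition essentially_coercive :: "('a::euclidean_space \<Rightarrow> real) \<Rightarrow> bool" where
  "essentially_coercive F \<longleftrightarrow>
    (\<exists>l::'a \<Rightarrow> real. linear l \<and> filterlim (\<lambda>x. F x - l x) at_top at_infinity)"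

text \<open>Here and below, the data \<open>f\<close> and \<open>G\<close> on \<open>E\<close> are
  total functions of which only the values on \<open>E\<close> are used.\<close>

definition convex_C1_extension ::
  "'a::euclidean_space set \<Rightarrow> ('a \<Rightarrow> real) \<Rightarrow> ('a \<Rightarrow> 'a) \<Rightarrow> ('a \<Rightarrow> real) \<Rightarrow> bool" where
  "convex_C1_extension E f G F \<longleftrightarrow>
    convex_on UNIV F \<and> class_C1 F \<and> (\<forall>x\<in>E. F x = f x \<and> GDERIV F x :> G x)"

definition cond_i :: "'a::euclidean_space set \<Rightarrow> ('a \<Rightarrow> real) \<Rightarrow> ('a \<Rightarrow> 'a) \<Rightarrow> bool" where
  "cond_i E f G \<longleftrightarrow>
    continuous_on E G \<and> (\<forall>x\<in>E. \<forall>y\<in>E. f x \<ge> f y + G y \<bullet> (x - y))"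

definition cond_ii :: "'a::euclidean_space set \<Rightarrow> ('a \<Rightarrow> real) \<Rightarrow> ('a \<Rightarrow> 'a) \<Rightarrow> bool" where
  "cond_ii E f G \<longleftrightarrow>
    (\<forall>x::nat \<Rightarrow> 'a. (\<forall>k. x k \<in> E) \<longrightarrow>
      filterlim (\<lambda>k. norm (G (x k))) at_top sequentially \<longrightarrow>
      filterlim (\<lambda>k. (G (x k) \<bullet> x k - f (x k)) / norm (G (x k))) at_top sequentially)"

definition cond_iii :: "'a::euclidean_space set \<Rightarrow> ('a \<Rightarrow> real) \<Rightarrow> ('a \<Rightarrow> 'a) \<Rightarrow> bool" where
  "cond_iii E f G \<longleftrightarrow>
    (\<forall>(x::nat \<Rightarrow> 'a) (z::nat \<Rightarrow> 'a).
      (\<forall>k. x k \<in> E) \<longrightarrow> (\<forall>k. z k \<in> E) \<longrightarrow>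
      bounded (range x) \<longrightarrow> bounded (range (\<lambda>k. G (z k))) \<longrightarrow>
      (\<lambda>k. f (x k) - f (z k) - G (z k) \<bullet> (x k - z k)) \<longlonglongrightarrow> 0 \<longrightarrow>
      (\<lambda>k. norm (G (x k) - G (z k))) \<longlonglongrightarrow> 0)"

end

(* Let m(x) be the supremum over y in E of the tangent functions f(y) + <G(y), x - y>. It is finite
   by (ii), agrees with f on E, and is coercive up to a linear function by the span hypothesis;
   by (iii) it lies o(|v|) above the tangents, uniformly for base points in bounded parts of E.
   Adding to the tangent at y a smooth majorant of this excess and taking the infimum over y gives
   g >= m with g = f on E. The convex envelope F of g lies between m and g, hence equals f on E.
   One-sided second-difference bounds pass from g to F by coercivity, and a convex function with
   such bounds is C^1. Its gradient at y in E is G(y), because the tangent at y supports F. *)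

theory Submission
  imports Defs
begin

text \<open>The function m may have kinks off E, and no modulus of continuity of G is given, so a
  quadratic correction of the tangents would not do. An upper bound on second differences survives
  both an infimum and a convex envelope, because a function or a convex combination that is nearly
  optimal at \<open>x\<close> can be reused at \<open>x + h\<close> and \<open>x - h\<close>;
  convexity supplies the missing lower bound at the very end. Two losses of compactness shape the
  rest. E may be unbounded while the excess is controlled only for y in bounded sets: hence
  majorants indexed by the size of y, and an extra |x - y|^2 that keeps nearly optimal y close to x.
  In the envelope, points of a convex combination could run off to infinity: growth of m above a
  linear function prevents this, so coercivity is part of the construction and not only an extra
  conclusion.\<close>

section \<open>Subgradients of finite convex functions\<close>

lemma subgradient_exists:
  fixes F :: "'a::euclidean_space \<Rightarrow> real"
  assumes "convex_on UNIV F"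
  obtains p where "\<And>y. F x + p \<bullet> (y - x) \<le> F y"
proof -
  let ?S = "{(x, F x)}" and ?T = "{(y, t). F y < t}"
  have cT: "convex ?T"
    unfolding convex_def
  proof (clarsimp)
    fix a b c d :: 'a and s t u v :: real
    assume *: "F a < s" "F b < t" "0 \<le> u" "0 \<le> v" "u + v = 1"
    have "F (u *\<^sub>R a + v *\<^sub>R b) \<le> u * F a + v * F b"
      using assms * unfolding convex_on_def by auto
    also have "\<dots> < u * s + v * t"
    proof (cases "u = 0")
      case True then show ?thesis using * by simp
    next
      case False
      then have "u * F a < u * s" using * by simp
      moreover have "v * F b \<le> v * t" using * by (intro mult_left_mono) auto
      ultimately show ?thesis by simp
    qed
    finally show "F (u *\<^sub>R a + v *\<^sub>R b) < u * s + v * t" .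
  qed
  have "(x, F x + 1) \<in> ?T" by simp
  then have "?T \<noteq> {}" by blast
  then have "\<exists>w b. w \<noteq> 0 \<and> (\<forall>z\<in>?S. w \<bullet> z \<le> b) \<and> (\<forall>z\<in>?T. b \<le> w \<bullet> z)"
    using cT by (intro separating_hyperplane_sets) auto
  then obtain w b where w: "w \<noteq> 0" "\<And>z. z \<in> ?S \<Longrightarrow> w \<bullet> z \<le> b" "\<And>z. z \<in> ?T \<Longrightarrow> b \<le> w \<bullet> z"
    by blast
  obtain a c where ac: "w = (a, c)" by (cases w)
  have sep: "a \<bullet> x + c * F x \<le> a \<bullet> y + c * t" if "F y < t" for y t
    using w(2)[of "(x, F x)"] w(3)[of "(y, t)"] that by (simp add: ac inner_prod_def)
  have "c \<ge> 0" using sep[of x "F x + 1"] by (simp add: algebra_simps)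
  \<comment> \<open>The separating hyperplane cannot be vertical because \<open>F\<close> is finite
    on the whole space.\<close>
  moreover have "c \<noteq> 0"
  proof
    assume "c = 0"
    then have "a \<bullet> x \<le> a \<bullet> y" for y using sep[of y "F y + 1"] by simp
    from this[of "x - a"] have "a \<bullet> a \<le> 0" by (simp add: inner_diff_right)
    then have "a = 0" by (metis inner_gt_zero_iff not_less)
    then show False using w(1) \<open>c = 0\<close> ac by (simp add: zero_prod_def)
  qed
  ultimately have c: "c > 0" by simp
  have sep': "a \<bullet> x + c * F x \<le> a \<bullet> y + c * F y" for y
  proof (rule field_le_epsilon)
    fix e :: real assume "e > 0"
    then show "a \<bullet> x + c * F x \<le> a \<bullet> y + c * F y + e"
      using sep[of y "F y + e / c"] c by (simp add: algebra_simps)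
  qed
  have "F x + (- (a /\<^sub>R c)) \<bullet> (y - x) \<le> F y" for y
    using sep'[of y] c by (simp add: field_simps inner_diff_right)
  then show ?thesis by (rule that)
qed

text \<open>The difference of \<open>F\<close> and its affine minorant is minimal at
  \<open>x\<close>, so its derivative vanishes there. This fixes the gradient of the extension on
  \<open>E\<close>, where only a tangent below \<open>F\<close> is known.\<close>

lemma touching_support_eq_gradient:
  fixes F :: "'a::real_inner \<Rightarrow> real"
  assumes "GDERIV F x :> D" and "\<And>y. F x + p \<bullet> (y - x) \<le> F y"
  shows "D = p"
proof -
  have "((\<lambda>y. F y - p \<bullet> y) has_derivative (\<lambda>h. h \<bullet> D - p \<bullet> h)) (at x)"
    using assms(1) unfolding gderiv_def by (auto intro!: derivative_eq_intros)
  moreover have "F x - p \<bullet> x \<le> F y - p \<bullet> y" for y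
    using assms(2)[of y] by (simp add: inner_diff_right)
  ultimately have "(\<lambda>h. h \<bullet> D - p \<bullet> h) = (\<lambda>h. 0)"
    by (intro has_derivative_local_min[where f = "\<lambda>y. F y - p \<bullet> y"]) auto
  then have "(D - p) \<bullet> D - p \<bullet> (D - p) = 0" by meson
  then have "(D - p) \<bullet> (D - p) = 0" by (simp add: algebra_simps inner_commute)
  then show ?thesis by simp
qed

lemma convex_GDERIV_support:
  fixes F :: "'a::euclidean_space \<Rightarrow> real"
  assumes "convex_on UNIV F" "GDERIV F x :> D"
  shows "F x + D \<bullet> (y - x) \<le> F y"
  by (metis assms subgradient_exists touching_support_eq_gradient)

lemma convex_bounded_on_cball:
  fixes F :: "'a::euclidean_space \<Rightarrow> real"
  assumes "convex_on UNIV F"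
  obtains C where "C > 0" "\<And>x. norm x \<le> R \<Longrightarrow> \<bar>F x\<bar> \<le> C"
proof -
  have "continuous_on (cball 0 R) F"
    using convex_on_continuous[OF open_UNIV assms] continuous_on_subset by blast
  then have "bounded (F ` cball 0 R)"
    by (intro compact_imp_bounded compact_continuous_image) auto
  then obtain C where "C > 0" "\<forall>y\<in>F ` cball 0 R. norm y \<le> C"
    unfolding bounded_pos by auto
  then show ?thesis using that[of C] by auto
qed

text \<open>The inequality is tested one unit away from \<open>x\<close> in the direction of
  \<open>p\<close>, where its left side exceeds \<open>F x\<close> by \<open>norm p\<close>.\<close>

lemma subgradient_norm_le:
  fixes F :: "'a::real_inner \<Rightarrow> real"
  assumes "\<And>y. F x + p \<bullet> (y - x) \<le> F y" and "\<And>y. norm y \<le> norm x + 1 \<Longrightarrow> \<bar>F y\<bar> \<le> C"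
  shows "norm p \<le> 2 * C"
proof (cases "p = 0")
  case True
  then show ?thesis using assms(2)[of x] by simp
next
  case False
  define y where "y = x + p /\<^sub>R norm p"
  have "norm y \<le> norm x + norm (p /\<^sub>R norm p)" unfolding y_def by (rule norm_triangle_ineq)
  then have "norm y \<le> norm x + 1" using False by simp
  moreover have "p \<bullet> (y - x) = norm p"
    using False by (simp add: y_def dot_square_norm power2_eq_square)
  ultimately show ?thesis using assms(1)[of y] assms(2)[of y] assms(2)[of x] by simp
qed

section \<open>One-sided second differences and C^1 regularity\<close>

text \<open>Locally uniform first-order smoothness from above, stated without gradients so that it
  passes to infima and to convex envelopes.\<close>

definition upper_smooth :: "('a::real_normed_vector \<Rightarrow> real) \<Rightarrow> bool" where
  "upper_smooth \<phi> \<longleftrightarrow> (\<forall>R. \<forall>e>0. \<exists>d>0. \<forall>x h. norm x \<le> R \<longrightarrow> norm h \<le> d \<longrightarrow>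
     \<phi> (x + h) + \<phi> (x - h) - 2 * \<phi> x \<le> e * norm h)"

lemma upper_smoothE:
  assumes "upper_smooth \<phi>" "e > 0"
  obtains d where "d > 0" "\<And>x h. norm x \<le> R \<Longrightarrow> norm h \<le> d \<Longrightarrow>
     \<phi> (x + h) + \<phi> (x - h) - 2 * \<phi> x \<le> e * norm h"
  using assms unfolding upper_smooth_def by meson

lemma upper_smooth_add:
  assumes "upper_smooth \<phi>" "upper_smooth \<psi>"
  shows "upper_smooth (\<lambda>x. \<phi> x + \<psi> x)"
  unfolding upper_smooth_def
proof (intro allI impI)
  fix R e :: real assume "e > 0"
  then have e: "e / 2 > 0" by simp
  from upper_smoothE[OF assms(1) e] obtain d1 where d1: "d1 > 0" "\<And>x h. norm x \<le> R \<Longrightarrow> norm h \<le> d1 \<Longrightarrow>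
     \<phi> (x + h) + \<phi> (x - h) - 2 * \<phi> x \<le> e / 2 * norm h" by blast
  from upper_smoothE[OF assms(2) e] obtain d2 where d2: "d2 > 0" "\<And>x h. norm x \<le> R \<Longrightarrow> norm h \<le> d2 \<Longrightarrow>
     \<psi> (x + h) + \<psi> (x - h) - 2 * \<psi> x \<le> e / 2 * norm h" by blast
  have "\<phi> (x + h) + \<psi> (x + h) + (\<phi> (x - h) + \<psi> (x - h)) - 2 * (\<phi> x + \<psi> x) \<le> e * norm h"
    if "norm x \<le> R" "norm h \<le> min d1 d2" for x h
    using d1(2)[of x h] d2(2)[of x h] that by simp
  then show "\<exists>d>0. \<forall>x h. norm x \<le> R \<longrightarrow> norm h \<le> d \<longrightarrow>
     \<phi> (x + h) + \<psi> (x + h) + (\<phi> (x - h) + \<psi> (x - h)) - 2 * (\<phi> x + \<psi> x) \<le> e * norm h"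
    using d1(1) d2(1) by (intro exI[of _ "min d1 d2"]) auto
qed

text \<open>A subgradient at \<open>x\<close> bounds \<open>F (x - h)\<close> from below; inserted
  in the second difference, it leaves a first-order bound on \<open>F (x + h)\<close> from above, to
  match its own bound from below. Uniformity on balls then makes the gradient continuous.\<close>

lemma convex_upper_smooth_imp_class_C1:
  fixes F :: "'a::euclidean_space \<Rightarrow> real"
  assumes cvx: "convex_on UNIV F" and us: "upper_smooth F"
  shows "class_C1 F"
proof -
  have "\<exists>p. \<forall>y. F x + p \<bullet> (y - x) \<le> F y" for x
    using subgradient_exists[OF cvx, of x] by metis
  then obtain p where p: "\<And>x y. F x + p x \<bullet> (y - x) \<le> F y" by metis
  have up: "\<exists>d>0. \<forall>x h. norm x \<le> R \<longrightarrow> norm h \<le> d \<longrightarrow> F (x + h) - F x - p x \<bullet> h \<le> e * norm h"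
    if e: "e > 0" for R e
  proof -
    from upper_smoothE[OF us e] obtain d where d: "d > 0" "\<And>x h. norm x \<le> R \<Longrightarrow> norm h \<le> d \<Longrightarrow>
      F (x + h) + F (x - h) - 2 * F x \<le> e * norm h" by blast
    have "F (x + h) - F x - p x \<bullet> h \<le> e * norm h" if "norm x \<le> R" "norm h \<le> d" for x h
      using d(2)[OF that] p[of x "x - h"] by simp
    then show ?thesis using d(1) by blast
  qed
  have grad: "GDERIV F x :> p x" for x
    unfolding gderiv_def has_derivative_at_alt
  proof (intro conjI allI impI)
    show "bounded_linear (\<lambda>h. h \<bullet> p x)" by (rule bounded_linear_inner_left)
    fix e :: real assume "e > 0"
    from up[OF this, of "norm x"] obtain d where d: "d > 0"
      "\<And>z h. norm z \<le> norm x \<Longrightarrow> norm h \<le> d \<Longrightarrow> F (z + h) - F z - p z \<bullet> h \<le> e * norm h" by blast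
    have "norm (F y - F x - (y - x) \<bullet> p x) \<le> e * norm (y - x)" if "norm (y - x) < d" for y
      using d(2)[of x "y - x"] p[of x y] that by (simp add: inner_commute)
    then show "\<exists>d>0. \<forall>y. norm (y - x) < d \<longrightarrow>
        norm (F y - F x - (y - x) \<bullet> p x) \<le> e * norm (y - x)"
      using d(1) by blast
  qed
  have "continuous_on UNIV p"
    unfolding continuous_on_iff
  proof (intro ballI allI impI)
    fix x :: 'a and e :: real assume "e > 0"
    then have "e / 4 > 0" by simp
    from up[OF this, of "norm x"] obtain d where d: "d > 0"
      "\<And>z h. norm z \<le> norm x \<Longrightarrow> norm h \<le> d \<Longrightarrow> F (z + h) - F z - p z \<bullet> h \<le> e / 4 * norm h" by blast
    have "dist (p z) (p x) < e" if z: "dist z x < d / 2" for z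
    proof (cases "p z = p x")
      case True then show ?thesis using \<open>e > 0\<close> by simp
    next
      case False
      \<comment> \<open>The test point is \<open>x + k = z + w\<close>, with \<open>w\<close> of
        length \<open>d / 2\<close> along \<open>q\<close>. The supports at \<open>z\<close> and
        \<open>x\<close> from below and the upper bound at \<open>x\<close> give
        \<open>q \<bullet> w \<le> e / 4 * d\<close>, that is
        \<open>norm q \<le> e / 2\<close>.\<close>
      define q where "q = p z - p x"
      have q: "norm q > 0" using False by (simp add: q_def)
      define w where "w = (d / 2 / norm q) *\<^sub>R q"
      have nw: "norm w = d / 2" using q d(1) by (simp add: w_def)
      define k where "k = (z - x) + w"
      have k: "norm k \<le> d" unfolding k_def
        using norm_triangle_ineq[of "z - x" w] z nw by (simp add: dist_norm)
      have "F (x + k) - F x - p x \<bullet> k \<le> e / 4 * norm k" using d(2)[of x k] k by simp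
      moreover have "e / 4 * norm k \<le> e / 4 * d" using k \<open>e > 0\<close> by (intro mult_left_mono) auto
      moreover have "F z + p z \<bullet> w \<le> F (x + k)" using p[of z "x + k"] by (simp add: k_def)
      moreover have "F x + p x \<bullet> (z - x) \<le> F z" using p by simp
      ultimately have "q \<bullet> w \<le> e / 4 * d" by (simp add: q_def k_def inner_diff_left inner_add_right)
      moreover have "q \<bullet> w = d / 2 * norm q" using q by (simp add: w_def dot_square_norm power2_eq_square)
      ultimately have "d * norm q \<le> d * (e / 2)" by (simp add: field_simps)
      then have "norm q \<le> e / 2" using d(1) by simp
      then show ?thesis using \<open>e > 0\<close> by (simp add: q_def dist_norm)
    qed
    then show "\<exists>d>0. \<forall>z\<in>UNIV. dist z x < d \<longrightarrow> dist (p z) (p x) < e"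
      using d(1) by (intro exI[of _ "d / 2"]) auto
  qed
  with grad show ?thesis unfolding class_C1_def by blast
qed

section \<open>Smooth majorants of a function that is at most o(|v|) near 0\<close>

lemma radial_excess_le:
  fixes w u :: "'a::real_normed_vector"
  assumes "norm u \<le> k"
  shows "(max 0 (norm w - k))\<^sup>2 \<le> (norm (w - u))\<^sup>2"
  using norm_triangle_ineq2[of w u] assms by (intro power_mono) auto

text \<open>The function here is the squared distance to the ball of radius \<open>k\<close>, an infimum of
  the functions \<open>|x - u|\<^sup>2\<close>; the nearest \<open>u\<close> to \<open>x\<close> is fixed for all three terms.\<close>

lemma radial_excess_second_difference:
  fixes x h :: "'a::real_inner"
  assumes "0 \<le> k"
  shows "(max 0 (norm (x + h) - k))\<^sup>2 + (max 0 (norm (x - h) - k))\<^sup>2 - 2 * (max 0 (norm x - k))\<^sup>2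
    \<le> 2 * (norm h)\<^sup>2"
proof -
  define u where "u = (if norm x \<le> k then x else (k / norm x) *\<^sub>R x)"
  have u: "norm u \<le> k" using assms by (simp add: u_def)
  have "norm (x - u) = max 0 (norm x - k)"
  proof (cases "norm x \<le> k")
    case True
    then show ?thesis by (simp add: u_def)
  next
    case False
    then have x: "norm x > 0" using assms by linarith
    have "x - u = (1 - k / norm x) *\<^sub>R x" using False by (simp add: u_def algebra_simps)
    then have "norm (x - u) = \<bar>1 - k / norm x\<bar> * norm x" by simp
    also have "\<dots> = norm x - k" using False x by (simp add: abs_if field_simps)
    finally show ?thesis using False by simp
  qed
  \<comment> \<open>Parallelogram law for \<open>x - u\<close> and \<open>h\<close>.\<close>
  moreover have "(norm (x + h - u))\<^sup>2 + (norm (x - h - u))\<^sup>2 = 2 * (norm (x - u))\<^sup>2 + 2 * (norm h)\<^sup>2"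
    by (simp add: power2_norm_eq_inner inner_simps inner_commute)
  ultimately have "(norm (x + h - u))\<^sup>2 + (norm (x - h - u))\<^sup>2
      = 2 * (max 0 (norm x - k))\<^sup>2 + 2 * (norm h)\<^sup>2" by simp
  then show ?thesis
    using radial_excess_le[OF u, of "x + h"] radial_excess_le[OF u, of "x - h"] by linarith
qed

lemma upper_smooth_quadratic_bound:
  assumes "\<And>R. \<exists>C. \<forall>x h. norm x \<le> R \<longrightarrow> norm h \<le> 1 \<longrightarrow>
    \<phi> (x + h) + \<phi> (x - h) - 2 * \<phi> x \<le> C * (norm h)\<^sup>2"
  shows "upper_smooth \<phi>"
  unfolding upper_smooth_def
proof (intro allI impI)
  fix R e :: real assume e: "e > 0"
  from assms[of R] obtain C where C: "\<And>x h. norm x \<le> R \<Longrightarrow> norm h \<le> 1 \<Longrightarrow>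
    \<phi> (x + h) + \<phi> (x - h) - 2 * \<phi> x \<le> C * (norm h)\<^sup>2" by metis
  define d where "d = min 1 (e / (\<bar>C\<bar> + 1))"
  have d: "d > 0" using e by (simp add: d_def)
  have "\<phi> (x + h) + \<phi> (x - h) - 2 * \<phi> x \<le> e * norm h" if "norm x \<le> R" "norm h \<le> d" for x h
  proof -
    have "norm h * (\<bar>C\<bar> + 1) \<le> e" using that(2) by (simp add: d_def field_simps)
    moreover have "C * norm h \<le> norm h * (\<bar>C\<bar> + 1)"
      using mult_right_mono[of C "\<bar>C\<bar> + 1" "norm h"] by (simp add: mult.commute)
    ultimately have "C * norm h * norm h \<le> e * norm h" by (intro mult_right_mono) auto
    then show ?thesis using C[of x h] that by (simp add: d_def power2_eq_square mult.assoc)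
  qed
  then show "\<exists>d>0. \<forall>x h. norm x \<le> R \<longrightarrow> norm h \<le> d \<longrightarrow>
      \<phi> (x + h) + \<phi> (x - h) - 2 * \<phi> x \<le> e * norm h"
    using d by blast
qed

text \<open>A weighted sum of squared distances to the balls of radius \<open>k\<close> grows as
  fast as desired, and only finitely many terms are nonzero on a bounded set. Inside the unit ball
  it is a multiple of |v|^2, which need not dominate a function that is merely o(|v|); hence the
  restriction to \<open>1 \<le> norm v\<close>.\<close>

lemma radial_growth_majorant:
  fixes \<psi> :: "'a::real_inner \<Rightarrow> real"
  assumes bdd: "\<And>R. \<exists>C. \<forall>v. norm v \<le> R \<longrightarrow> \<psi> v \<le> C"
  obtains P where "upper_smooth P" "\<And>v. 0 \<le> P v" "P 0 = 0" "\<And>v. 1 \<le> norm v \<Longrightarrow> \<psi> v \<le> P v"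
    "\<And>R. \<exists>C. \<forall>v. norm v \<le> R \<longrightarrow> P v \<le> C"
proof -
  from bdd have "\<forall>k::nat. \<exists>C. \<forall>v. norm v \<le> real k + 2 \<longrightarrow> \<psi> v \<le> C" by blast
  then obtain c' where c': "\<And>k v. norm v \<le> real k + 2 \<Longrightarrow> \<psi> v \<le> c' k" by metis
  define c where "c k = max 0 (c' k)" for k
  have c: "c k \<ge> 0" "norm v \<le> real k + 2 \<Longrightarrow> \<psi> v \<le> c k" for k v
    using c'[of v k] by (auto simp: c_def)
  define s where "s k v = c k * (max 0 (norm v - real k))\<^sup>2" for k :: nat and v :: 'a
  have s0: "s k v \<ge> 0" for k v using c by (simp add: s_def)
  define P where "P v = (\<Sum>k < nat \<lceil>norm v\<rceil>. s k v)" for v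
  have P_eq: "P v = (\<Sum>k<M. s k v)" if "norm v \<le> real M" for v M
    unfolding P_def
  proof (rule sum.mono_neutral_left)
    show "{..<nat \<lceil>norm v\<rceil>} \<subseteq> {..<M}" using that by (auto simp: ceiling_le_iff)
    show "\<forall>k\<in>{..<M} - {..<nat \<lceil>norm v\<rceil>}. s k v = 0"
    proof
      fix k assume "k \<in> {..<M} - {..<nat \<lceil>norm v\<rceil>}"
      then have "norm v \<le> real k" by (auto simp: not_less)
      then show "s k v = 0" by (simp add: s_def)
    qed
  qed auto
  show ?thesis
  proof (rule that)
    show "upper_smooth P"
    proof (rule upper_smooth_quadratic_bound)
      fix R :: real
      define M where "M = nat \<lceil>\<bar>R\<bar> + 1\<rceil>"
      have M: "\<bar>R\<bar> + 1 \<le> real M" by (simp add: M_def)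
      have "P (x + h) + P (x - h) - 2 * P x \<le> (\<Sum>k<M. c k) * 2 * (norm h)\<^sup>2"
        if "norm x \<le> R" "norm h \<le> 1" for x h
      proof -
        have "norm (x + h) \<le> real M" "norm (x - h) \<le> real M" "norm x \<le> real M"
          using norm_triangle_ineq[of x h] norm_triangle_ineq4[of x h] that M by linarith+
        then have "P (x + h) + P (x - h) - 2 * P x = (\<Sum>k<M. s k (x + h) + s k (x - h) - 2 * s k x)"
          by (simp add: P_eq sum.distrib sum_subtractf sum_distrib_left)
        also have "\<dots> \<le> (\<Sum>k<M. c k * (2 * (norm h)\<^sup>2))"
        proof (rule sum_mono)
          fix k
          have "s k (x + h) + s k (x - h) - 2 * s k x = c k * ((max 0 (norm (x + h) - real k))\<^sup>2
              + (max 0 (norm (x - h) - real k))\<^sup>2 - 2 * (max 0 (norm x - real k))\<^sup>2)"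
            by (simp add: s_def algebra_simps)
          also have "\<dots> \<le> c k * (2 * (norm h)\<^sup>2)"
            using c(1) by (intro mult_left_mono radial_excess_second_difference) auto
          finally show "s k (x + h) + s k (x - h) - 2 * s k x \<le> c k * (2 * (norm h)\<^sup>2)" .
        qed
        also have "\<dots> = (\<Sum>k<M. c k) * 2 * (norm h)\<^sup>2" by (simp add: sum_distrib_right mult.assoc)
        finally show ?thesis .
      qed
      then show "\<exists>C. \<forall>x h. norm x \<le> R \<longrightarrow> norm h \<le> 1 \<longrightarrow>
          P (x + h) + P (x - h) - 2 * P x \<le> C * (norm h)\<^sup>2" by blast
    qed
    show "0 \<le> P v" for v unfolding P_def by (intro sum_nonneg s0)
    show "P 0 = 0" by (simp add: P_def)
    show "\<psi> v \<le> P v" if "1 \<le> norm v" for v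
    proof -
      \<comment> \<open>This picks the shell \<open>k + 1 \<le> norm v \<le> k + 2\<close>: the
        distance to the ball of radius \<open>k\<close> is at least 1, and the weight
        \<open>c k\<close> bounds \<open>\<psi> v\<close>.\<close>
      define k where "k = nat (\<lfloor>norm v\<rfloor> - 1)"
      have fl: "1 \<le> \<lfloor>norm v\<rfloor>" using that by simp
      then have k: "real k = of_int \<lfloor>norm v\<rfloor> - 1" by (simp add: k_def)
      have k1: "real k + 1 \<le> norm v" "norm v \<le> real k + 2" unfolding k by linarith+
      have "\<psi> v \<le> c k" using c(2) k1(2) by simp
      also have "\<dots> \<le> c k * (max 0 (norm v - real k))\<^sup>2"
        using c(1)[of k] k1(1) one_le_power[of "max 0 (norm v - real k)" 2]
          mult_left_mono[of 1 "(max 0 (norm v - real k))\<^sup>2" "c k"] by simp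
      also have "\<dots> = s k v" by (simp add: s_def)
      also have "\<dots> \<le> P v" unfolding P_def
      proof (rule member_le_sum)
        show "k \<in> {..<nat \<lceil>norm v\<rceil>}" using k1 by (simp add: zless_nat_eq_int_zless less_ceiling_iff)
      qed (auto intro: s0)
      finally show ?thesis .
    qed
    show "\<exists>C. \<forall>v. norm v \<le> R \<longrightarrow> P v \<le> C" for R
    proof -
      define M where "M = nat \<lceil>\<bar>R\<bar>\<rceil>"
      have M: "\<bar>R\<bar> \<le> real M" by (simp add: M_def)
      have "P v \<le> (\<Sum>k<M. c k * (real M)\<^sup>2)" if "norm v \<le> R" for v
      proof -
        have v: "norm v \<le> real M" using that M by linarith
        have "P v = (\<Sum>k<M. s k v)" using v by (rule P_eq)
        also have "\<dots> \<le> (\<Sum>k<M. c k * (real M)\<^sup>2)"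
          unfolding s_def using v c(1) by (intro sum_mono mult_left_mono power_mono) auto
        finally show ?thesis .
      qed
      then show ?thesis by blast
    qed
  qed
qed

text \<open>The majorant is the infimum of the functions \<open>a + b|v|\<^sup>2\<close> lying above \<open>\<psi>\<close>. A nearly optimal
  one at \<open>x\<close> has \<open>b|x|\<^sup>2\<close> at most about \<open>\<phi> x\<close>, so \<open>b|h|\<^sup>2\<close> is small compared with \<open>|h|\<close>
  as long as \<open>|h| \<le> |x|\<close>; for \<open>|x| \<le> |h|\<close> it suffices that \<open>\<phi>\<close> is \<open>o(|v|)\<close> at \<open>0\<close>.\<close>

lemma unit_ball_majorant:
  fixes \<psi> :: "'a::real_inner \<Rightarrow> real"
  assumes bdd: "\<And>v. norm v \<le> 1 \<Longrightarrow> \<psi> v \<le> C"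
    and small: "\<And>e. e > 0 \<Longrightarrow> \<exists>d>0. \<forall>v. norm v \<le> d \<longrightarrow> \<psi> v \<le> e * norm v"
  obtains \<phi> where "upper_smooth \<phi>" "\<And>v. 0 \<le> \<phi> v" "\<phi> 0 = 0" "\<And>v. norm v \<le> 1 \<Longrightarrow> \<psi> v \<le> \<phi> v"
    "\<And>v. \<phi> v \<le> \<bar>C\<bar>"
proof -
  define A where "A = {(a::real, b::real). 0 \<le> a \<and> 0 \<le> b \<and> (\<forall>v. norm v \<le> 1 \<longrightarrow> \<psi> v \<le> a + b * (norm v)\<^sup>2)}"
  define q where "q v p = fst p + snd p * (norm v)\<^sup>2" for v :: 'a and p :: "real \<times> real"
  define \<phi> where "\<phi> v = (INF p\<in>A. q v p)" for v
  have CA: "(\<bar>C\<bar>, 0) \<in> A" unfolding A_def using bdd by (auto intro: order_trans[OF _ abs_ge_self])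
  have A0: "fst p \<ge> 0" "snd p \<ge> 0" if "p \<in> A" for p using that by (auto simp: A_def)
  have q0: "q v p \<ge> 0" if "p \<in> A" for v p using A0[OF that] by (simp add: q_def)
  have bb: "bdd_below (q v ` A)" for v using q0 by (intro bdd_belowI2[where m = 0]) auto
  have le: "\<phi> v \<le> q v p" if "p \<in> A" for v p unfolding \<phi>_def using bb that by (rule cINF_lower)
  have near: "\<exists>p\<in>A. q v p < \<phi> v + \<eta>" if "\<eta> > 0" for v \<eta>
    using cINF_less_iff[OF _ bb, of v "\<phi> v + \<eta>"] CA that unfolding \<phi>_def by auto
  have nonneg: "\<phi> v \<ge> 0" for v unfolding \<phi>_def using CA q0 by (intro cINF_greatest) auto
  have \<phi>C: "\<phi> v \<le> \<bar>C\<bar>" for v using le[OF CA, of v] by (simp add: q_def)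
  \<comment> \<open>By AM-GM,
    \<open>e * norm v \<le> e * t / 2 + e / (2 * t) * (norm v)\<^sup>2\<close>, with equality at
    \<open>norm v = t\<close>; the constant \<open>K = \<bar>C\<bar> / d\<^sup>2\<close> covers
    \<open>d < norm v \<le> 1\<close>. The free \<open>t\<close> is later taken small at
    \<open>v = 0\<close> and equal to \<open>norm v\<close> elsewhere.\<close>
  have upper: "\<exists>K\<ge>0. \<forall>v. \<forall>t>0. \<phi> v \<le> e * t / 2 + (e / (2 * t) + K) * (norm v)\<^sup>2" if e: "e > 0" for e
  proof -
    from small[OF e] obtain d where d: "d > 0" "\<And>v. norm v \<le> d \<Longrightarrow> \<psi> v \<le> e * norm v" by blast
    have "\<phi> v \<le> e * t / 2 + (e / (2 * t) + \<bar>C\<bar> / d\<^sup>2) * (norm v)\<^sup>2" if t: "t > 0" for v t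
    proof -
      have "(e * t / 2, e / (2 * t) + \<bar>C\<bar> / d\<^sup>2) \<in> A"
        unfolding A_def
      proof (clarsimp, intro conjI allI impI)
        show "0 \<le> e * t" "0 \<le> e / (2 * t) + \<bar>C\<bar> / d\<^sup>2" using e t by simp_all
        fix v :: 'a assume v: "norm v \<le> 1"
        show "\<psi> v \<le> e * t / 2 + (e / (2 * t) + \<bar>C\<bar> / d\<^sup>2) * (norm v)\<^sup>2"
        proof (cases "norm v \<le> d")
          case True
          have "0 \<le> (t - norm v)\<^sup>2 * (e / (2 * t))" using e t by simp
          also have "\<dots> = e * t / 2 + e / (2 * t) * (norm v)\<^sup>2 - e * norm v"
            using t by (simp add: power2_eq_square field_simps)
          finally have "e * norm v \<le> e * t / 2 + e / (2 * t) * (norm v)\<^sup>2" by simp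
          moreover have "0 \<le> \<bar>C\<bar> / d\<^sup>2 * (norm v)\<^sup>2" by simp
          ultimately show ?thesis using d(2)[OF True] unfolding distrib_right by linarith
        next
          case False
          then have "d\<^sup>2 \<le> (norm v)\<^sup>2" using d(1) by (intro power_mono) auto
          then have "1 \<le> (norm v)\<^sup>2 / d\<^sup>2" using d(1) by simp
          then have "\<bar>C\<bar> * 1 \<le> \<bar>C\<bar> * ((norm v)\<^sup>2 / d\<^sup>2)" by (intro mult_left_mono) auto
          then have "\<bar>C\<bar> \<le> \<bar>C\<bar> / d\<^sup>2 * (norm v)\<^sup>2" by simp
          moreover have "0 \<le> e * t / 2 + e / (2 * t) * (norm v)\<^sup>2" using e t by simp
          ultimately show ?thesis using bdd[OF v] unfolding distrib_right by linarith
        qed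
      qed
      from le[OF this, of v] show ?thesis by (simp add: q_def)
    qed
    then show ?thesis using d(1) by (intro exI[of _ "\<bar>C\<bar> / d\<^sup>2"]) auto
  qed
  have \<phi>0: "\<phi> 0 = 0"
  proof (rule antisym[OF field_le_epsilon nonneg])
    fix e :: real assume "e > 0"
    from upper[OF zero_less_one] obtain K where "\<forall>t>0. \<phi> 0 \<le> 1 * t / 2 + (1 / (2 * t) + K) * (norm (0::'a))\<^sup>2"
      by blast
    then show "\<phi> 0 \<le> 0 + e" using \<open>e > 0\<close> by (auto dest: spec[of _ "2 * e"])
  qed
  have \<phi>small: "\<exists>d>0. \<forall>v. norm v \<le> d \<longrightarrow> \<phi> v \<le> e * norm v" if e: "e > 0" for e
  proof -
    from e have "e / 2 > 0" by simp
    from upper[OF this] obtain K where K: "K \<ge> 0"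
      "\<And>v t. t > 0 \<Longrightarrow> \<phi> v \<le> e / 2 * t / 2 + (e / 2 / (2 * t) + K) * (norm v)\<^sup>2" by blast
    define d where "d = e / 2 / (K + 1)"
    have d: "d > 0" using e K by (simp add: d_def)
    have "\<phi> v \<le> e * norm v" if "norm v \<le> d" for v
    proof (cases "v = 0")
      case True then show ?thesis by (simp add: \<phi>0)
    next
      case False
      then have v: "norm v > 0" by simp
      have "\<phi> v \<le> e / 2 * norm v / 2 + (e / 2 / (2 * norm v) + K) * (norm v)\<^sup>2" by (rule K(2)[OF v])
      also have "\<dots> = e / 2 * norm v + K * norm v * norm v"
        using v by (simp add: power2_eq_square field_simps)
      also have "K * norm v * norm v \<le> e / 2 * norm v"
      proof (rule mult_right_mono)
        have "(K + 1) * norm v \<le> e / 2" using that K(1) by (simp add: d_def field_simps)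
        then show "K * norm v \<le> e / 2" using v unfolding distrib_right by linarith
      qed (use v in simp)
      finally show ?thesis by simp
    qed
    with d show ?thesis by blast
  qed
  have "upper_smooth \<phi>"
    unfolding upper_smooth_def
  proof (intro allI impI)
    fix R e :: real assume e: "e > 0"
    then have "e / 4 > 0" by simp
    from \<phi>small[OF this] obtain r where r: "r > 0" "\<And>v. norm v \<le> r \<Longrightarrow> \<phi> v \<le> e / 4 * norm v" by blast
    \<comment> \<open>The first entry keeps \<open>x + h\<close> and \<open>x - h\<close> within
      radius \<open>r\<close> when \<open>norm x \<le> norm h\<close>. The second gives
      \<open>snd p * norm h \<le> e / 2\<close> when \<open>norm x > r\<close>, where
      \<open>snd p \<le> (\<bar>C\<bar> + 1) / r\<^sup>2\<close>.\<close>
    define d where "d = min (r / 2) (e * r\<^sup>2 / (2 * (\<bar>C\<bar> + 1)))"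
    have d: "d > 0" using e r by (simp add: d_def)
    have "\<phi> (x + h) + \<phi> (x - h) - 2 * \<phi> x \<le> e * norm h" if h: "norm h \<le> d" for x h
    proof (cases "norm x \<le> norm h")
      case True
      have n: "norm (x + h) \<le> 2 * norm h" "norm (x - h) \<le> 2 * norm h"
        using norm_triangle_ineq[of x h] norm_triangle_ineq4[of x h] True by linarith+
      have "2 * norm h \<le> r" using h by (simp add: d_def)
      then have "\<phi> (x + h) \<le> e / 4 * norm (x + h)" "\<phi> (x - h) \<le> e / 4 * norm (x - h)"
        using r(2) n by auto
      moreover have "e / 4 * norm (x + h) \<le> e / 4 * (2 * norm h)" "e / 4 * norm (x - h) \<le> e / 4 * (2 * norm h)"
        using n e by (auto intro: mult_left_mono)
      ultimately show ?thesis using nonneg[of x] by simp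
    next
      case False
      show ?thesis
      proof (rule field_le_epsilon)
        fix \<epsilon> :: real assume "\<epsilon> > 0"
        define \<eta> where "\<eta> = min 1 (\<epsilon> / 4)"
        have \<eta>: "\<eta> > 0" "\<eta> \<le> 1" "4 * \<eta> \<le> \<epsilon>" using \<open>\<epsilon> > 0\<close> by (auto simp: \<eta>_def)
        from near[OF \<eta>(1), of x] obtain p where p: "p \<in> A" "q x p < \<phi> x + \<eta>" by blast
        \<comment> \<open>The quadratic that is nearly optimal at \<open>x\<close> serves all three
          points.\<close>
        have par: "q (x + h) p + q (x - h) p - 2 * q x p = 2 * (snd p * (norm h)\<^sup>2)"
          by (simp add: q_def power2_norm_eq_inner inner_simps inner_commute algebra_simps)
        have bx: "snd p * (norm x)\<^sup>2 \<le> \<phi> x + \<eta>" using p(2) A0[OF p(1)] by (simp add: q_def)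
        have x: "norm x > 0" using False by (meson not_le norm_ge_zero order.trans order.strict_trans1)
        have b: "2 * (snd p * (norm h)\<^sup>2) \<le> e * norm h + 2 * \<eta>"
        proof (cases "norm x \<le> r")
          case True
          \<comment> \<open>Of the factor \<open>\<rho>\<^sup>2\<close> relating
            \<open>(norm h)\<^sup>2\<close> to \<open>(norm x)\<^sup>2\<close>, one
            \<open>\<rho>\<close> turns \<open>norm x\<close> into \<open>norm h\<close>; the other
            is bounded by 1.\<close>
          define \<rho> where "\<rho> = norm h / norm x"
          have \<rho>: "0 \<le> \<rho>" "\<rho> \<le> 1" "norm h = \<rho> * norm x" using False x by (auto simp: \<rho>_def)
          then have \<rho>2: "\<rho>\<^sup>2 \<le> \<rho>" "\<rho>\<^sup>2 \<le> 1" by (auto simp: power2_eq_square mult_left_le mult_le_one)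
          have "snd p * (norm h)\<^sup>2 = \<rho>\<^sup>2 * (snd p * (norm x)\<^sup>2)" by (simp add: \<rho>(3) power_mult_distrib)
          also have "\<dots> \<le> \<rho>\<^sup>2 * (e / 4 * norm x + \<eta>)"
            using bx r(2)[OF True] by (intro mult_left_mono) auto
          also have "\<dots> = \<rho>\<^sup>2 * (e / 4 * norm x) + \<rho>\<^sup>2 * \<eta>" by (simp add: distrib_left)
          also have "\<dots> \<le> \<rho> * (e / 4 * norm x) + 1 * \<eta>"
            using \<rho>2 e x \<eta>(1) by (intro add_mono mult_right_mono) auto
          also have "\<dots> = e / 4 * norm h + \<eta>" by (simp add: \<rho>(3))
          also have "\<dots> \<le> e / 2 * norm h + \<eta>" using e by (simp add: mult_right_mono)
          finally show ?thesis by simp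
        next
          case False
          have "snd p * r\<^sup>2 \<le> snd p * (norm x)\<^sup>2"
            using False r(1) A0[OF p(1)] by (intro mult_left_mono power_mono) auto
          also have "\<dots> \<le> \<bar>C\<bar> + 1" using bx \<phi>C[of x] \<eta>(2) by linarith
          finally have "snd p \<le> (\<bar>C\<bar> + 1) / r\<^sup>2" using r(1) by (simp add: field_simps)
          then have "snd p * norm h \<le> (\<bar>C\<bar> + 1) / r\<^sup>2 * d" using h r(1) A0[OF p(1)]
            by (intro mult_mono) auto
          also have "\<dots> \<le> (\<bar>C\<bar> + 1) / r\<^sup>2 * (e * r\<^sup>2 / (2 * (\<bar>C\<bar> + 1)))"
            by (intro mult_left_mono) (auto simp: d_def)
          also have "\<dots> = e / 2"
          proof -
            have "k / r\<^sup>2 * (e * r\<^sup>2 / (2 * k)) = e / 2" if "k > 0" for k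
              using that r(1) by (simp add: field_simps)
            from this[of "\<bar>C\<bar> + 1"] show ?thesis by simp
          qed
          finally have "snd p * norm h * norm h \<le> e / 2 * norm h" by (intro mult_right_mono) auto
          then show ?thesis using \<eta>(1) by (simp add: power2_eq_square mult.assoc)
        qed
        show "\<phi> (x + h) + \<phi> (x - h) - 2 * \<phi> x \<le> e * norm h + \<epsilon>"
          using le[OF p(1), of "x + h"] le[OF p(1), of "x - h"] par p(2) b \<eta> by linarith
      qed
    qed
    with d show "\<exists>d>0. \<forall>x h. norm x \<le> R \<longrightarrow> norm h \<le> d \<longrightarrow>
        \<phi> (x + h) + \<phi> (x - h) - 2 * \<phi> x \<le> e * norm h" by blast
  qed
  moreover have "\<psi> v \<le> \<phi> v" if "norm v \<le> 1" for v
    unfolding \<phi>_def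
  proof (rule cINF_greatest)
    show "A \<noteq> {}" using CA by blast
  qed (use that in \<open>auto simp: A_def q_def\<close>)
  ultimately show ?thesis using nonneg \<phi>0 \<phi>C that by blast
qed

text \<open>Two majorants, one for each side of the unit sphere, are added; being nonnegative,
  neither spoils the other.\<close>

lemma upper_smooth_majorant:
  fixes \<psi> :: "'a::real_inner \<Rightarrow> real"
  assumes bdd: "\<And>R. \<exists>C. \<forall>v. norm v \<le> R \<longrightarrow> \<psi> v \<le> C"
    and small: "\<And>e. e > 0 \<Longrightarrow> \<exists>d>0. \<forall>v. norm v \<le> d \<longrightarrow> \<psi> v \<le> e * norm v"
  obtains \<phi> where "upper_smooth \<phi>" "\<phi> 0 = 0" "\<And>v. \<psi> v \<le> \<phi> v"
    "\<And>R. \<exists>C. \<forall>v. norm v \<le> R \<longrightarrow> \<phi> v \<le> C"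
proof -
  from radial_growth_majorant[OF bdd] obtain P where P: "upper_smooth P" "\<And>v. 0 \<le> P v" "P 0 = 0"
    "\<And>v. 1 \<le> norm v \<Longrightarrow> \<psi> v \<le> P v" "\<And>R. \<exists>C. \<forall>v. norm v \<le> R \<longrightarrow> P v \<le> C" by blast
  from bdd[of 1] obtain C where C: "\<And>v. norm v \<le> 1 \<Longrightarrow> \<psi> v \<le> C" by blast
  from unit_ball_majorant[OF C small] obtain \<phi> where \<phi>: "upper_smooth \<phi>" "\<And>v. 0 \<le> \<phi> v" "\<phi> 0 = 0"
    "\<And>v. norm v \<le> 1 \<Longrightarrow> \<psi> v \<le> \<phi> v" "\<And>v. \<phi> v \<le> \<bar>C\<bar>" by blast
  have "\<psi> v \<le> \<phi> v + P v" for v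
    using P(2,4)[of v] \<phi>(2,4)[of v] by linarith
  moreover have "\<exists>B. \<forall>v. norm v \<le> R \<longrightarrow> \<phi> v + P v \<le> B" for R
    using P(5)[of R] \<phi>(5) by (meson add_mono)
  ultimately show ?thesis
    using that[of "\<lambda>v. \<phi> v + P v"] upper_smooth_add[OF \<phi>(1) P(1)] \<phi>(3) P(3) by simp
qed

section \<open>The infimum of the raised tangents\<close>

text \<open>Each base point gets a majorant chosen by the integer part of its size, since the excess
  is uniform only over bounded sets of base points. On a ball the nearly optimal base points stay
  bounded, so only finitely many majorants matter and their second-difference bounds have a common
  \<open>d\<close>.\<close>

lemma upper_smooth_tangent_envelope:
  fixes f m :: "'a::real_inner \<Rightarrow> real" and G :: "'a \<Rightarrow> 'a"
  assumes ne: "E \<noteq> {}"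
    and below: "\<And>R. \<exists>C. \<forall>x. norm x \<le> R \<longrightarrow> - C \<le> m x"
    and bdd: "\<And>R r. \<exists>C. \<forall>y\<in>E. \<forall>v. norm y \<le> R \<longrightarrow> norm v \<le> r \<longrightarrow> m (y + v) - f y - G y \<bullet> v \<le> C"
    and small: "\<And>R e. e > 0 \<Longrightarrow> \<exists>d>0. \<forall>y\<in>E. \<forall>v. norm y \<le> R \<longrightarrow> norm v \<le> d \<longrightarrow>
      m (y + v) - f y - G y \<bullet> v \<le> e * norm v"
  obtains g where "upper_smooth g" "\<And>x. m x \<le> g x" "\<And>y. y \<in> E \<Longrightarrow> g y \<le> f y"
proof -
  from ne obtain y0 where y0: "y0 \<in> E" by blast
  \<comment> \<open>Starting at radius \<open>norm y0\<close> keeps every \<open>S N\<close>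
    nonempty, so that suprema over it are meaningful.\<close>
  define S where "S N = {y \<in> E. norm y \<le> norm y0 + real N}" for N
  define ex where "ex v y = m (y + v) - f y - G y \<bullet> v" for v y
  \<comment> \<open>The added square preserves the o(|v|) bound and penalises distant base
    points.\<close>
  define \<psi> where "\<psi> N v = (SUP y\<in>S N. ex v y) + (norm v)\<^sup>2" for N and v :: 'a
  have Sne: "S N \<noteq> {}" for N using y0 by (auto simp: S_def)
  have SE: "y \<in> E" "norm y \<le> norm y0 + real N" if "y \<in> S N" for y N using that by (auto simp: S_def)
  have exb: "\<exists>C. \<forall>y\<in>S N. \<forall>v. norm v \<le> r \<longrightarrow> ex v y \<le> C" for N r
    using bdd[of "norm y0 + real N" r] SE unfolding ex_def by metis
  have ex_le: "ex v y + (norm v)\<^sup>2 \<le> \<psi> N v" if "y \<in> S N" for v y N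
  proof -
    from exb[of N "norm v"] obtain C where "\<And>y. y \<in> S N \<Longrightarrow> ex v y \<le> C" by blast
    then have "bdd_above (ex v ` S N)" by (rule bdd_aboveI2)
    then show ?thesis unfolding \<psi>_def using that by (auto intro: cSUP_upper)
  qed
  have "\<exists>\<phi>. upper_smooth \<phi> \<and> \<phi> 0 = 0 \<and> (\<forall>v. \<psi> N v \<le> \<phi> v) \<and>
      (\<forall>R. \<exists>C. \<forall>v. norm v \<le> R \<longrightarrow> \<phi> v \<le> C)" for N
  proof (rule upper_smooth_majorant)
    show "\<exists>C. \<forall>v. norm v \<le> R \<longrightarrow> \<psi> N v \<le> C" for R
    proof -
      from exb[of N R] obtain C where C: "\<And>y v. y \<in> S N \<Longrightarrow> norm v \<le> R \<Longrightarrow> ex v y \<le> C" by blast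
      have "\<psi> N v \<le> C + R\<^sup>2" if "norm v \<le> R" for v
        unfolding \<psi>_def using C that Sne by (intro add_mono cSUP_least power_mono) auto
      then show ?thesis by blast
    qed
    show "\<exists>d>0. \<forall>v. norm v \<le> d \<longrightarrow> \<psi> N v \<le> e * norm v" if e: "e > 0" for e
    proof -
      from e have "e / 2 > 0" by simp
      from small[OF this, of "norm y0 + real N"] obtain d where d: "d > 0"
        "\<And>y v. y \<in> E \<Longrightarrow> norm y \<le> norm y0 + real N \<Longrightarrow> norm v \<le> d \<Longrightarrow> ex v y \<le> e / 2 * norm v"
        unfolding ex_def by metis
      have "\<psi> N v \<le> e * norm v" if v: "norm v \<le> min d (e / 2)" for v
      proof -
        have "(SUP y\<in>S N. ex v y) \<le> e / 2 * norm v"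
          using d(2) SE v Sne by (intro cSUP_least) auto
        moreover have "(norm v)\<^sup>2 \<le> e / 2 * norm v"
          unfolding power2_eq_square using v by (intro mult_right_mono) auto
        ultimately show ?thesis by (simp add: \<psi>_def)
      qed
      then show ?thesis using d(1) e by (intro exI[of _ "min d (e / 2)"]) auto
    qed
  qed blast
  then obtain \<phi> where \<phi>: "\<And>N. upper_smooth (\<phi> N)" "\<And>N. \<phi> N 0 = 0" "\<And>N v. \<psi> N v \<le> \<phi> N v"
    "\<And>N R. \<exists>C. \<forall>v. norm v \<le> R \<longrightarrow> \<phi> N v \<le> C" by metis
  define ix where "ix y = nat \<lceil>norm y\<rceil>" for y :: 'a
  have ixS: "y \<in> S (ix y)" if "y \<in> E" for y
  proof -
    have "norm y \<le> real (ix y)" by (simp add: ix_def)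
    then have "norm y \<le> norm y0 + real (ix y)" by (metis add_increasing norm_ge_zero)
    then show ?thesis using that by (simp add: S_def)
  qed
  define q where "q y x = f y + G y \<bullet> (x - y) + \<phi> (ix y) (x - y)" for y x
  have q_lower: "m x + (norm (x - y))\<^sup>2 \<le> q y x" if "y \<in> E" for x y
    using ex_le[OF ixS[OF that], of "x - y"] \<phi>(3)[of "ix y" "x - y"] by (simp add: q_def ex_def)
  then have q_m: "m x \<le> q y x" if "y \<in> E" for x y using that by (smt (verit) zero_le_power2)
  have bb: "bdd_below ((\<lambda>y. q y x) ` E)" for x using q_m by (rule bdd_belowI2)
  define g where "g x = (INF y\<in>E. q y x)" for x
  have g_le: "g x \<le> q y x" if "y \<in> E" for x y unfolding g_def using bb that by (rule cINF_lower)
  have near: "\<exists>y\<in>E. q y x < g x + \<eta>" if "\<eta> > 0" for x \<eta>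
    using cINF_less_iff[OF ne bb, of x "g x + \<eta>"] that unfolding g_def by auto
  show ?thesis
  proof (rule that)
    show "m x \<le> g x" for x unfolding g_def using ne q_m by (intro cINF_greatest)
    show "g y \<le> f y" if "y \<in> E" for y using g_le[OF that, of y] by (simp add: q_def \<phi>(2))
    show "upper_smooth g"
      unfolding upper_smooth_def
    proof (intro allI impI)
      fix R e :: real assume e: "e > 0"
      from below[of R] obtain C where C: "\<And>x. norm x \<le> R \<Longrightarrow> - C \<le> m x" by blast
      from \<phi>(4)[of "R + norm y0" "ix y0"] obtain B where
        B: "\<And>v. norm v \<le> R + norm y0 \<Longrightarrow> \<phi> (ix y0) v \<le> B" by blast
      \<comment> \<open>An upper bound for \<open>g\<close> on the ball, obtained from the single
        base point \<open>y0\<close>.\<close>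
      define T where "T = f y0 + norm (G y0) * (R + norm y0) + B"
      have T: "g x \<le> T" if "norm x \<le> R" for x
      proof -
        have n: "norm (x - y0) \<le> R + norm y0" using norm_triangle_ineq4[of x y0] that by linarith
        have "G y0 \<bullet> (x - y0) \<le> norm (G y0) * norm (x - y0)" by (rule norm_cauchy_schwarz)
        also have "\<dots> \<le> norm (G y0) * (R + norm y0)" using n by (intro mult_left_mono) auto
        finally show ?thesis using g_le[OF y0, of x] B[OF n] by (simp add: q_def T_def)
      qed
      \<comment> \<open>A base point \<open>y\<close> nearly optimal at \<open>x\<close> satisfies
        \<open>(norm (x - y))\<^sup>2 \<le> T + 1 + C\<close>. The maximum with 1 gives
        \<open>L \<le> L\<^sup>2\<close>, hence \<open>norm (x - y) \<le> L\<close>.\<close>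
      define L where "L = max 1 (T + 1 + C)"
      define N where "N = nat \<lceil>R + L\<rceil>"
      have "\<exists>d>0. \<forall>x h. norm x \<le> L \<longrightarrow> norm h \<le> d \<longrightarrow>
          \<phi> k (x + h) + \<phi> k (x - h) - 2 * \<phi> k x \<le> e * norm h" for k
        using \<phi>(1)[of k] e unfolding upper_smooth_def by blast
      then obtain d where d: "\<And>k. d k > 0" "\<And>k x h. norm x \<le> L \<Longrightarrow> norm h \<le> d k \<Longrightarrow>
          \<phi> k (x + h) + \<phi> k (x - h) - 2 * \<phi> k x \<le> e * norm h" by metis
      define \<delta> where "\<delta> = Min (d ` {..N})"
      have \<delta>: "\<delta> > 0" "\<And>k. k \<le> N \<Longrightarrow> \<delta> \<le> d k" using d(1) by (auto simp: \<delta>_def)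
      have "g (x + h) + g (x - h) - 2 * g x \<le> e * norm h" if x: "norm x \<le> R" and h: "norm h \<le> \<delta>" for x h
      proof (rule field_le_epsilon)
        fix \<epsilon> :: real assume "\<epsilon> > 0"
        define \<eta> where "\<eta> = min 1 (\<epsilon> / 2)"
        have \<eta>: "\<eta> > 0" "\<eta> \<le> 1" "2 * \<eta> \<le> \<epsilon>" using \<open>\<epsilon> > 0\<close> by (auto simp: \<eta>_def)
        from near[OF \<eta>(1), of x] obtain y where y: "y \<in> E" "q y x < g x + \<eta>" by blast
        have "(norm (x - y))\<^sup>2 \<le> L"
          using q_lower[OF y(1), of x] y(2) T[OF x] C[OF x] \<eta>(2) by (simp add: L_def)
        also have "L \<le> L\<^sup>2" by (rule self_le_power) (simp_all add: L_def)
        finally have xy: "norm (x - y) \<le> L" by (rule power2_le_imp_le) (simp add: L_def)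
        have "norm y \<le> R + L" using norm_triangle_ineq2[of y x] xy x by (simp add: norm_minus_commute)
        then have "ix y \<le> N" unfolding ix_def N_def by (intro nat_mono ceiling_mono)
        then have "norm h \<le> d (ix y)" using \<delta>(2) h by (meson order_trans)
        from d(2)[OF xy this] have "q y (x + h) + q y (x - h) - 2 * q y x \<le> e * norm h"
          by (simp add: q_def inner_simps algebra_simps)
        then show "g (x + h) + g (x - h) - 2 * g x \<le> e * norm h + \<epsilon>"
          using g_le[OF y(1), of "x + h"] g_le[OF y(1), of "x - h"] y(2) \<eta>(3) by linarith
      qed
      then show "\<exists>d>0. \<forall>x h. norm x \<le> R \<longrightarrow> norm h \<le> d \<longrightarrow>
          g (x + h) + g (x - h) - 2 * g x \<le> e * norm h" using \<delta>(1) by blast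
    qed
  qed
qed

section \<open>The convex envelope\<close>

text \<open>Coercivity forces half of the mass of a nearly optimal convex combination into a fixed ball.
  To estimate the envelope at \<open>x \<plusminus> h\<close>, only those points are moved.\<close>

lemma upper_smooth_convex_envelope:
  fixes g m :: "'a::euclidean_space \<Rightarrow> real"
  assumes us: "upper_smooth g" and m: "convex_on UNIV m" "\<And>x. m x \<le> g x"
    and co: "c > 0" "\<And>x. p \<bullet> x + c * norm x - C \<le> m x"
  obtains F where "convex_on UNIV F" "upper_smooth F" "\<And>x. m x \<le> F x" "\<And>x. F x \<le> g x"
proof -
  \<comment> \<open>The envelope is the lower boundary of the convex hull of the graph of
    \<open>g\<close>; the hull lies above \<open>m\<close>, so the infima are finite.\<close>
  define H where "H = convex hull (range (\<lambda>x. (x, g x)))"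
  define F where "F x = Inf {t. (x, t) \<in> H}" for x
  have "H \<subseteq> epigraph UNIV m"
    unfolding H_def using m by (intro hull_minimal) (auto simp: mem_epigraph convex_epigraph)
  then have H_m: "m x \<le> t" if "(x, t) \<in> H" for x t using that by (auto simp: mem_epigraph)
  have H_g: "(x, g x) \<in> H" for x unfolding H_def by (intro hull_inc) auto
  have bb: "bdd_below {t. (x, t) \<in> H}" for x using H_m by (intro bdd_belowI[where m = "m x"]) auto
  have F_le: "F x \<le> t" if "(x, t) \<in> H" for x t
    unfolding F_def using that bb by (intro cInf_lower) auto
  have F_m: "m x \<le> F x" for x unfolding F_def using H_g H_m by (intro cInf_greatest) auto
  have F_g: "F x \<le> g x" for x by (intro F_le H_g)
  have near: "\<exists>t. (x, t) \<in> H \<and> t < F x + \<eta>" if "\<eta> > 0" for x \<eta>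
  proof -
    have "{t. (x, t) \<in> H} \<noteq> {}" using H_g by blast
    from cInf_less_iff[OF this bb, of "F x + \<eta>"] that show ?thesis unfolding F_def by auto
  qed
  have cvx: "convex_on UNIV F"
  proof (rule convex_onI)
    fix t :: real and x y :: 'a assume t: "0 < t" "t < 1"
    show "F ((1 - t) *\<^sub>R x + t *\<^sub>R y) \<le> (1 - t) * F x + t * F y"
    proof (rule field_le_epsilon)
      fix \<epsilon> :: real assume \<epsilon>: "\<epsilon> > 0"
      from near[OF \<epsilon>] obtain a b where ab: "(x, a) \<in> H" "a < F x + \<epsilon>" "(y, b) \<in> H" "b < F y + \<epsilon>" by meson
      have "(1 - t) *\<^sub>R (x, a) + t *\<^sub>R (y, b) \<in> H"
        unfolding H_def using ab t unfolding H_def by (intro convexD convex_convex_hull) auto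
      then have "F ((1 - t) *\<^sub>R x + t *\<^sub>R y) \<le> (1 - t) * a + t * b" by (intro F_le) simp
      also have "\<dots> \<le> (1 - t) * (F x + \<epsilon>) + t * (F y + \<epsilon>)" using ab t by (intro add_mono mult_left_mono) auto
      also have "\<dots> = (1 - t) * F x + t * F y + \<epsilon>" by (simp add: algebra_simps)
      finally show "F ((1 - t) *\<^sub>R x + t *\<^sub>R y) \<le> (1 - t) * F x + t * F y + \<epsilon>" .
    qed
  qed simp
  have "upper_smooth F"
    unfolding upper_smooth_def
  proof (intro allI impI)
    fix R e :: real assume e: "e > 0"
    from convex_bounded_on_cball[OF cvx, of R] obtain B where B: "\<And>x. norm x \<le> R \<Longrightarrow> \<bar>F x\<bar> \<le> B" by metis
    \<comment> \<open>Averaging the coercive lower bound over a nearly optimal combination, whose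
      value is at most \<open>B + 1\<close>, bounds the mean of the norms of its points by
      \<open>M\<close>.\<close>
    define M where "M = max 1 ((B + 1 + C + norm p * R) / c)"
    have M: "M > 0" by (simp add: M_def)
    from upper_smoothE[OF us e, of "2 * M"] obtain d where d: "d > 0"
      "\<And>x h. norm x \<le> 2 * M \<Longrightarrow> norm h \<le> d \<Longrightarrow> g (x + h) + g (x - h) - 2 * g x \<le> e * norm h" by metis
    have "F (x + h) + F (x - h) - 2 * F x \<le> e * norm h" if x: "norm x \<le> R" and h: "norm h \<le> d / 2" for x h
    proof (rule field_le_epsilon)
      fix \<epsilon> :: real assume "\<epsilon> > 0"
      define \<eta> where "\<eta> = min 1 (\<epsilon> / 2)"
      have \<eta>: "\<eta> > 0" "\<eta> \<le> 1" "2 * \<eta> \<le> \<epsilon>" using \<open>\<epsilon> > 0\<close> by (auto simp: \<eta>_def)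
      from near[OF \<eta>(1), of x] obtain t where t: "(x, t) \<in> H" "t < F x + \<eta>" by blast
      from t(1) obtain k :: nat and u z where kuz: "\<forall>i\<in>{1..k}. 0 \<le> u i \<and> z i \<in> range (\<lambda>x. (x, g x))"
        "sum u {1..k} = 1" "(\<Sum>i = 1..k. u i *\<^sub>R z i) = (x, t)"
        unfolding H_def convex_hull_indexed by blast
      define I where "I = {1..k}"
      define X where "X i = fst (z i)" for i
      have u: "0 \<le> u i" "z i = (X i, g (X i))" if "i \<in> I" for i
      proof -
        have "0 \<le> u i \<and> z i \<in> range (\<lambda>x. (x, g x))" using kuz(1) that by (simp add: I_def)
        then show "0 \<le> u i" "z i = (X i, g (X i))" by (auto simp: X_def)
      qed
      have finI: "finite I" by (simp add: I_def)
      have u1: "sum u I = 1" using kuz(2) by (simp add: I_def)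
      have "(\<Sum>i\<in>I. (u i *\<^sub>R X i, u i * g (X i))) = (\<Sum>i\<in>I. u i *\<^sub>R z i)"
        by (intro sum.cong) (simp_all add: u(2))
      also have "\<dots> = (x, t)" using kuz(3) by (simp only: I_def)
      finally have sums: "(\<Sum>i\<in>I. u i *\<^sub>R X i) = x" "(\<Sum>i\<in>I. u i * g (X i)) = t"
        by (simp_all add: sum_prod)
      have F_sum: "F (\<Sum>i\<in>I. u i *\<^sub>R Y i) \<le> (\<Sum>i\<in>I. u i * g (Y i))" for Y
      proof -
        have "(\<Sum>i\<in>I. u i *\<^sub>R (Y i, g (Y i))) \<in> H"
          using H_g u(1) u1 finI unfolding H_def by (intro convex_sum convex_convex_hull) auto
        then show ?thesis by (intro F_le) (simp add: sum_prod)
      qed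
      have mass: "(\<Sum>i\<in>I. u i * norm (X i)) \<le> M"
      proof -
        have "(\<Sum>i\<in>I. C * u i) = C" by (simp add: sum_distrib_left[symmetric] u1)
        then have "p \<bullet> x + c * (\<Sum>i\<in>I. u i * norm (X i)) - C = (\<Sum>i\<in>I. u i * (p \<bullet> X i + c * norm (X i) - C))"
          unfolding sums(1)[symmetric]
          by (simp add: inner_sum_right sum_distrib_left sum.distrib sum_subtractf algebra_simps)
        also have "\<dots> \<le> t"
          unfolding sums(2)[symmetric] using u(1) order_trans[OF co(2) m(2)]
          by (intro sum_mono mult_left_mono) auto
        also have "t \<le> B + 1" using t(2) B[OF x] \<eta>(2) by linarith
        finally have "c * (\<Sum>i\<in>I. u i * norm (X i)) \<le> B + 1 + C - p \<bullet> x" by simp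
        also have "\<dots> \<le> B + 1 + C + norm p * R"
        proof -
          have "- (p \<bullet> x) \<le> norm p * norm x" using norm_cauchy_schwarz[of "- p" x] by simp
          also have "\<dots> \<le> norm p * R" using x by (intro mult_left_mono) auto
          finally show ?thesis by simp
        qed
        finally have "(\<Sum>i\<in>I. u i * norm (X i)) \<le> (B + 1 + C + norm p * R) / c"
          using co(1) by (simp add: field_simps)
        then show ?thesis by (simp add: M_def)
      qed
      \<comment> \<open>Markov's inequality: as the mean norm is at most \<open>M\<close>, points
        beyond \<open>2 * M\<close> carry at most half of the mass.\<close>
      define K where "K = {i \<in> I. norm (X i) \<le> 2 * M}"
      define \<mu> where "\<mu> = sum u K"
      have \<mu>: "\<mu> \<ge> 1 / 2"
      proof -
        have "2 * M * (1 - \<mu>) = (\<Sum>i\<in>I - K. u i * (2 * M))"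
          using sum_diff[of I K u] finI u1
          by (simp add: \<mu>_def K_def sum_distrib_right[symmetric])
        also have "\<dots> \<le> (\<Sum>i\<in>I - K. u i * norm (X i))"
          using u(1) by (intro sum_mono mult_left_mono) (auto simp: K_def)
        also have "\<dots> \<le> (\<Sum>i\<in>I. u i * norm (X i))"
          using u(1) finI by (intro sum_mono2) auto
        also have "\<dots> \<le> M" by (rule mass)
        finally show ?thesis using M by (simp add: field_simps)
      qed
      \<comment> \<open>Moving the mass \<open>\<mu>\<close> by \<open>h'\<close> moves the
        barycentre by exactly \<open>h\<close>, and
        \<open>norm h' \<le> 2 * norm h \<le> d\<close>.\<close>
      define h' where "h' = h /\<^sub>R \<mu>"
      have h': "\<mu> *\<^sub>R h' = h" "\<mu> * norm h' = norm h" using \<mu> by (auto simp: h'_def)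
      have "norm h' \<le> d"
      proof -
        have "1 / 2 * norm h' \<le> \<mu> * norm h'" using \<mu> by (intro mult_right_mono) auto
        then show ?thesis using h h'(2) by simp
      qed
      define w where "w i = (if i \<in> K then h' else 0)" for i
      have fil: "I \<inter> {i. i \<in> K} = K" by (auto simp: K_def)
      have "(\<Sum>i\<in>I. u i *\<^sub>R w i) = (\<Sum>i\<in>I. if i \<in> K then u i *\<^sub>R h' else 0)"
        by (intro sum.cong) (auto simp: w_def)
      also have "\<dots> = h"
        using finI fil by (simp add: sum.If_cases \<mu>_def h'(1)[symmetric] scaleR_sum_left)
      finally have sw: "(\<Sum>i\<in>I. u i *\<^sub>R w i) = h" .
      have "F (x + h) \<le> (\<Sum>i\<in>I. u i * g (X i + w i))"
        using F_sum[of "\<lambda>i. X i + w i"] by (simp add: scaleR_add_right sum.distrib sums(1) sw)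
      moreover have "F (x - h) \<le> (\<Sum>i\<in>I. u i * g (X i - w i))"
        using F_sum[of "\<lambda>i. X i - w i"] by (simp add: scaleR_diff_right sum_subtractf sums(1) sw)
      moreover have "(\<Sum>i\<in>I. u i * g (X i + w i)) + (\<Sum>i\<in>I. u i * g (X i - w i)) - 2 * t \<le> e * norm h"
      proof -
        have "(\<Sum>i\<in>I. u i * g (X i + w i)) + (\<Sum>i\<in>I. u i * g (X i - w i)) - 2 * t
            = (\<Sum>i\<in>I. u i * (g (X i + w i) + g (X i - w i) - 2 * g (X i)))"
          unfolding sums(2)[symmetric]
          by (simp add: algebra_simps sum.distrib sum_subtractf sum_distrib_left)
        \<comment> \<open>Points left in place contribute 0; over the moved ones, the total mass
          \<open>\<mu>\<close> turns \<open>norm h'\<close> back into \<open>norm h\<close>.\<close>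
        also have "\<dots> \<le> (\<Sum>i\<in>I. if i \<in> K then u i * (e * norm h') else 0)"
        proof (rule sum_mono)
          fix i assume i: "i \<in> I"
          show "u i * (g (X i + w i) + g (X i - w i) - 2 * g (X i))
              \<le> (if i \<in> K then u i * (e * norm h') else 0)"
            using d(2)[of "X i" h'] \<open>norm h' \<le> d\<close> u(1)[OF i]
            by (auto simp: w_def K_def intro!: mult_left_mono)
        qed
        also have "\<dots> = e * norm h"
          using finI fil by (simp add: sum.If_cases \<mu>_def h'(2)[symmetric] sum_distrib_left
              sum_distrib_right algebra_simps)
        finally show ?thesis .
      qed
      ultimately show "F (x + h) + F (x - h) - 2 * F x \<le> e * norm h + \<epsilon>"
        using t(2) \<eta>(3) by linarith
    qed
    then show "\<exists>d>0. \<forall>x h. norm x \<le> R \<longrightarrow> norm h \<le> d \<longrightarrow> F (x + h) + F (x - h) - 2 * F x \<le> e * norm h"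
      using d(1) by (intro exI[of _ "d / 2"]) auto
  qed
  then show ?thesis using that cvx F_m F_g by blast
qed

section \<open>Uniform forms of (ii) and (iii), and coercivity from the span\<close>

text \<open>If every \<open>B\<close> failed, counterexamples for \<open>B = k\<close> would form a
  sequence violating (ii).\<close>

lemma cond_ii_growth:
  assumes "cond_ii E f G"
  obtains B where "\<And>y. y \<in> E \<Longrightarrow> B \<le> norm (G y) \<Longrightarrow> A * norm (G y) \<le> G y \<bullet> y - f y"
proof -
  have "\<exists>B. \<forall>y\<in>E. B \<le> norm (G y) \<longrightarrow> A * norm (G y) \<le> G y \<bullet> y - f y"
  proof (rule ccontr)
    assume "\<not> ?thesis"
    then have "\<forall>k::nat. \<exists>y\<in>E. real k \<le> norm (G y) \<and> G y \<bullet> y - f y < A * norm (G y)"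
      by (meson not_le)
    then obtain x where x: "\<And>k::nat. x k \<in> E" "\<And>k. real k \<le> norm (G (x k))"
      "\<And>k. G (x k) \<bullet> x k - f (x k) < A * norm (G (x k))" by metis
    have lim: "filterlim (\<lambda>k. norm (G (x k))) at_top sequentially"
      using filterlim_at_top_mono[OF filterlim_real_sequentially] x(2) by auto
    then have "filterlim (\<lambda>k. (G (x k) \<bullet> x k - f (x k)) / norm (G (x k))) at_top sequentially"
      using assms x(1) unfolding cond_ii_def by blast
    then have "eventually (\<lambda>k. A \<le> (G (x k) \<bullet> x k - f (x k)) / norm (G (x k))) sequentially"
      unfolding filterlim_at_top by blast
    moreover have "eventually (\<lambda>k. 1 \<le> norm (G (x k))) sequentially"
      using lim unfolding filterlim_at_top by blast
    ultimately have "eventually (\<lambda>k. False) sequentially"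
    proof eventually_elim
      case (elim k)
      then have "norm (G (x k)) > 0" by linarith
      then have "A * norm (G (x k)) \<le> G (x k) \<bullet> x k - f (x k)"
        using elim(1) by (simp add: pos_le_divide_eq)
      then show ?case using x(3)[of k] by linarith
    qed
    then show False by simp
  qed
  then show ?thesis using that by blast
qed

text \<open>Counterexamples for \<open>\<eta> = 1 / (k + 1)\<close> would violate (iii): by (i) the
  gap is nonnegative, so it is squeezed to 0.\<close>

lemma cond_iii_uniform:
  assumes i: "cond_i E f G" and iii: "cond_iii E f G" and e: "e > 0"
  obtains \<eta> where "\<eta> > 0" "\<And>x z. x \<in> E \<Longrightarrow> z \<in> E \<Longrightarrow> norm x \<le> R \<Longrightarrow> norm (G z) \<le> R \<Longrightarrow>
    f x - f z - G z \<bullet> (x - z) \<le> \<eta> \<Longrightarrow> norm (G x - G z) < e"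
proof -
  have "\<exists>\<eta>>0. \<forall>x\<in>E. \<forall>z\<in>E. norm x \<le> R \<longrightarrow> norm (G z) \<le> R \<longrightarrow>
    f x - f z - G z \<bullet> (x - z) \<le> \<eta> \<longrightarrow> norm (G x - G z) < e"
  proof (rule ccontr)
    assume neg: "\<not> ?thesis"
    have "\<exists>x z. x \<in> E \<and> z \<in> E \<and> norm x \<le> R \<and> norm (G z) \<le> R \<and>
        f x - f z - G z \<bullet> (x - z) \<le> inverse (real (Suc k)) \<and> e \<le> norm (G x - G z)" for k
    proof -
      have "inverse (real (Suc k)) > 0" by simp
      with neg show ?thesis by (meson not_le)
    qed
    then obtain x z where xz: "\<And>k::nat. x k \<in> E" "\<And>k. z k \<in> E" "\<And>k. norm (x k) \<le> R"
      "\<And>k. norm (G (z k)) \<le> R"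
      "\<And>k. f (x k) - f (z k) - G (z k) \<bullet> (x k - z k) \<le> inverse (real (Suc k))"
      "\<And>k. e \<le> norm (G (x k) - G (z k))" by metis
    have "(\<lambda>k. f (x k) - f (z k) - G (z k) \<bullet> (x k - z k)) \<longlonglongrightarrow> 0"
    proof (rule tendsto_sandwich[OF _ _ tendsto_const LIMSEQ_inverse_real_of_nat])
      have "0 \<le> f (x k) - f (z k) - G (z k) \<bullet> (x k - z k)" for k
        using i xz(1,2) unfolding cond_i_def by (smt (verit))
      then show "\<forall>\<^sub>F k in sequentially. 0 \<le> f (x k) - f (z k) - G (z k) \<bullet> (x k - z k)" by simp
    qed (use xz(5) in simp)
    moreover have "bounded (range x)" "bounded (range (\<lambda>k. G (z k)))"
      using xz(3,4) by (auto intro!: boundedI)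
    ultimately have "(\<lambda>k. norm (G (x k) - G (z k))) \<longlonglongrightarrow> 0"
      using iii xz(1,2) unfolding cond_iii_def by blast
    then have "e \<le> 0" using xz(6) by (intro LIMSEQ_le_const) auto
    then show False using e by simp
  qed
  then show ?thesis using that by blast
qed

text \<open>The sum vanishes only at vectors orthogonal to a spanning set, that is at 0. Its minimum
  on the unit sphere is therefore positive and, by homogeneity, serves as \<open>c\<close>.\<close>

lemma spanning_abs_inner_lower_bound:
  fixes B :: "'a::euclidean_space set"
  assumes "finite B" "span B = UNIV"
  obtains c where "c > 0" "\<And>x. c * norm x \<le> (\<Sum>b\<in>B. \<bar>b \<bullet> x\<bar>)"
proof -
  define N where "N x = (\<Sum>b\<in>B. \<bar>b \<bullet> x\<bar>)" for x
  have "continuous_on (sphere 0 1) N" unfolding N_def by (intro continuous_intros)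
  moreover have "sphere (0::'a) 1 \<noteq> {}" by simp
  ultimately obtain z where z: "z \<in> sphere 0 1" "\<And>x. x \<in> sphere 0 1 \<Longrightarrow> N z \<le> N x"
    using continuous_attains_inf[of "sphere 0 1" N] by (auto simp: compact_sphere)
  have "N z \<noteq> 0"
  proof
    assume "N z = 0"
    then have "\<bar>b \<bullet> z\<bar> = 0" if "b \<in> B" for b
      using that assms(1) unfolding N_def by (subst (asm) sum_nonneg_eq_0_iff) auto
    then have "orthogonal z b" if "b \<in> B" for b using that by (simp add: orthogonal_def inner_commute)
    then have "orthogonal z z" using assms(2) by (intro orthogonal_to_span[of z B z]) auto
    then show False using z(1) by (simp add: orthogonal_self)
  qed
  moreover have "N z \<ge> 0" unfolding N_def by (intro sum_nonneg) auto
  ultimately have "N z > 0" by simp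
  moreover have "N z * norm x \<le> N x" for x
  proof (cases "x = 0")
    case False
    have "N (x /\<^sub>R norm x) = N x / norm x"
      unfolding N_def by (simp add: abs_mult divide_inverse mult.commute sum_distrib_left)
    moreover have "N z \<le> N (x /\<^sub>R norm x)" using False by (intro z(2)) simp
    ultimately have "N z \<le> N x / norm x" by simp
    then show ?thesis using False by (simp add: pos_le_divide_eq)
  qed (simp add: N_def)
  ultimately show ?thesis using that unfolding N_def by blast
qed

text \<open>Twice the maximum of two tangents is their sum plus the absolute value of their
  difference. For slopes differing by \<open>b\<close> this yields
  \<open>\<bar>b \<bullet> x\<bar>\<close> up to constants; averaging over a basis of such
  differences yields a multiple of \<open>norm x\<close>.\<close>

lemma max_affine_coercive:
  fixes G :: "'a::euclidean_space \<Rightarrow> 'a" and m :: "'a \<Rightarrow> real"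
  assumes sp: "span {G x - G y | x y. x \<in> E \<and> y \<in> E} = UNIV"
    and m: "\<And>x y. y \<in> E \<Longrightarrow> f y + G y \<bullet> (x - y) \<le> m x"
  obtains p c C where "c > 0" "\<And>x. p \<bullet> x + c * norm x - C \<le> m x"
proof -
  define D where "D = {G x - G y | x y. x \<in> E \<and> y \<in> E}"
  obtain B where B: "B \<subseteq> D" "independent B" "D \<subseteq> span B" using maximal_independent_subset by blast
  have fin: "finite B" using B(2) by (rule independent_imp_finite)
  have spB: "span B = UNIV"
    using span_mono[OF B(3)] sp by (simp add: D_def span_span top_unique)
  from spanning_abs_inner_lower_bound[OF fin spB] obtain c where
    c: "c > 0" "\<And>x. c * norm x \<le> (\<Sum>b\<in>B. \<bar>b \<bullet> x\<bar>)" by blast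
  have "B \<noteq> {}"
  proof
    assume "B = {}"
    then have "(UNIV :: 'a set) = {0}" using spB by simp
    then show False by (metis UNIV_I nonempty_Basis nonzero_Basis singletonD all_not_in_conv)
  qed
  then have n: "real (card B) > 0" using fin by (simp add: card_gt_0_iff)
  have "\<forall>b\<in>B. \<exists>x y. x \<in> E \<and> y \<in> E \<and> b = G x - G y" using B(1) unfolding D_def by blast
  then obtain X Y where XY: "\<And>b. b \<in> B \<Longrightarrow> X b \<in> E \<and> Y b \<in> E \<and> b = G (X b) - G (Y b)" by metis
  \<comment> \<open>The tangent at \<open>y\<close> is \<open>G y \<bullet> x - k y\<close>; the
    constants \<open>k\<close> are absorbed in \<open>\<kappa>\<close>.\<close>
  define k where "k y = G y \<bullet> y - f y" for y
  define s where "s = (\<Sum>b\<in>B. G (X b) + G (Y b))"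
  define \<kappa> where "\<kappa> = (\<Sum>b\<in>B. \<bar>k (X b)\<bar> + \<bar>k (Y b)\<bar>)"
  have "s \<bullet> x + c * norm x - 2 * \<kappa> \<le> 2 * real (card B) * m x" for x
  proof -
    have "s \<bullet> x + c * norm x - 2 * \<kappa> \<le> s \<bullet> x + (\<Sum>b\<in>B. \<bar>b \<bullet> x\<bar>) - 2 * \<kappa>" using c(2)[of x] by simp
    also have "\<dots> = (\<Sum>b\<in>B. (G (X b) + G (Y b)) \<bullet> x + \<bar>b \<bullet> x\<bar> - 2 * (\<bar>k (X b)\<bar> + \<bar>k (Y b)\<bar>))"
      by (simp add: s_def \<kappa>_def inner_sum_left inner_add_left sum.distrib sum_subtractf sum_distrib_left)
    also have "\<dots> \<le> (\<Sum>b\<in>B. 2 * m x)"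
    proof (rule sum_mono)
      fix b assume "b \<in> B"
      note b = XY[OF this]
      then have "b \<bullet> x = G (X b) \<bullet> x - G (Y b) \<bullet> x" by (metis inner_diff_left)
      moreover have "G (X b) \<bullet> x - k (X b) \<le> m x" "G (Y b) \<bullet> x - k (Y b) \<le> m x"
        using m[of "X b" x] m[of "Y b" x] b by (auto simp: k_def inner_diff_right)
      ultimately show "(G (X b) + G (Y b)) \<bullet> x + \<bar>b \<bullet> x\<bar> - 2 * (\<bar>k (X b)\<bar> + \<bar>k (Y b)\<bar>) \<le> 2 * m x"
        unfolding inner_add_left by (smt (verit))
    qed
    finally show ?thesis by simp
  qed
  then have "(s \<bullet> x + c * norm x - 2 * \<kappa>) / (2 * real (card B)) \<le> m x" for x
    using n by (simp add: pos_divide_le_eq mult.commute)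
  moreover have "(s /\<^sub>R (2 * real (card B))) \<bullet> x + c / (2 * real (card B)) * norm x - \<kappa> / real (card B)
      = (s \<bullet> x + c * norm x - 2 * \<kappa>) / (2 * real (card B))" for x
    using n by (simp add: field_simps)
  ultimately have bound: "(s /\<^sub>R (2 * real (card B))) \<bullet> x + c / (2 * real (card B)) * norm x
      - \<kappa> / real (card B) \<le> m x" for x
    by simp
  show ?thesis by (rule that[OF _ bound]) (use c(1) n in simp)
qed

lemma essentially_coerciveI:
  assumes c: "c > 0" and F: "\<And>x. p \<bullet> x + c * norm x - C \<le> F x"
  shows "essentially_coercive F"
  unfolding essentially_coercive_def
proof (intro exI conjI)
  show "linear (\<lambda>x. p \<bullet> x)" by (simp add: bounded_linear.linear bounded_linear_inner_right)
  show "filterlim (\<lambda>x. F x - p \<bullet> x) at_top at_infinity"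
    unfolding filterlim_at_top eventually_at_infinity
  proof (intro allI exI impI)
    fix Z and x :: 'a assume "(Z + C) / c \<le> norm x"
    then have "Z + C \<le> c * norm x" using c by (simp add: field_simps)
    then show "Z \<le> F x - p \<bullet> x" using F[of x] by linarith
  qed
qed

text \<open>By (ii), a tangent of large slope is at most \<open>- norm (G y)\<close> on the ball of
  radius \<open>R\<close>: this is \<open>R * norm (G y)\<close> minus
  \<open>(R + 1) * norm (G y)\<close>. Steep tangents are thus irrelevant to the supremum
  there.\<close>

lemma tangent_slopes_bounded:
  assumes "cond_ii E f G"
  obtains B where "\<And>x y. y \<in> E \<Longrightarrow> norm x \<le> R \<Longrightarrow> - C \<le> f y + G y \<bullet> (x - y) \<Longrightarrow> norm (G y) \<le> B"
proof -
  from cond_ii_growth[OF assms, of "R + 1"] obtain B where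
    B: "\<And>y. y \<in> E \<Longrightarrow> B \<le> norm (G y) \<Longrightarrow> (R + 1) * norm (G y) \<le> G y \<bullet> y - f y" by blast
  have "norm (G y) \<le> max B C" if y: "y \<in> E" "norm x \<le> R" "- C \<le> f y + G y \<bullet> (x - y)" for x y
  proof (cases "B \<le> norm (G y)")
    case True
    have "G y \<bullet> x \<le> norm (G y) * norm x" by (rule norm_cauchy_schwarz)
    also have "\<dots> \<le> norm (G y) * R" using y(2) by (intro mult_left_mono) auto
    finally have "norm (G y) \<le> C"
      using B[OF y(1) True] y(3) by (simp add: inner_diff_right algebra_simps)
    then show ?thesis by simp
  qed simp
  then show ?thesis by (rule that)
qed

section \<open>Sufficiency of the conditions\<close>

lemma convex_C1_extension_exists:
  fixes E :: "'a::euclidean_space set"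
  assumes sp: "span {G x - G y | x y. x \<in> E \<and> y \<in> E} = UNIV"
    and i: "cond_i E f G" and ii: "cond_ii E f G" and iii: "cond_iii E f G"
  obtains F where "convex_C1_extension E f G F" "essentially_coercive F"
proof -
  have ne: "E \<noteq> {}"
  proof
    assume "E = {}"
    then have "(UNIV :: 'a set) = {0}" using sp by simp
    then show False by (metis UNIV_I nonempty_Basis nonzero_Basis singletonD all_not_in_conv)
  qed
  have tan: "f y + G y \<bullet> (x - y) \<le> f x" if "x \<in> E" "y \<in> E" for x y
    using i that unfolding cond_i_def by blast
  from ne obtain x0 where x0: "x0 \<in> E" by blast
  define \<tau> where "\<tau> x y = f y + G y \<bullet> (x - y)" for x y
  define m where "m x = (SUP y\<in>E. \<tau> x y)" for x
  \<comment> \<open>Tangents nonnegative at \<open>x\<close> have bounded slopes, and at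
    \<open>x0\<close> they are at most \<open>f x0\<close>, so they cannot be large at
    \<open>x\<close>.\<close>
  have bb: "bdd_above (\<tau> x ` E)" for x
  proof -
    from tangent_slopes_bounded[OF ii, of "norm x" 0] obtain B where
      B: "\<And>y. y \<in> E \<Longrightarrow> 0 \<le> \<tau> x y \<Longrightarrow> norm (G y) \<le> B" unfolding \<tau>_def by (metis neg_0_equal_iff_equal order_refl)
    have "\<tau> x y \<le> max 0 (f x0 + B * norm (x - x0))" if y: "y \<in> E" for y
    proof (cases "0 \<le> \<tau> x y")
      case True
      have "\<tau> x y \<le> f x0 + G y \<bullet> (x - x0)"
        using tan[OF x0 y] by (simp add: \<tau>_def inner_diff_right)
      also have "G y \<bullet> (x - x0) \<le> norm (G y) * norm (x - x0)" by (rule norm_cauchy_schwarz)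
      also have "\<dots> \<le> B * norm (x - x0)" using B[OF y True] by (intro mult_right_mono) auto
      finally show ?thesis by simp
    qed simp
    then show ?thesis by (rule bdd_aboveI2)
  qed
  have \<tau>_m: "\<tau> x y \<le> m x" if "y \<in> E" for x y unfolding m_def using bb that by (intro cSUP_upper)
  have near: "\<exists>y\<in>E. s < \<tau> x y" if "s < m x" for x s
    using less_cSUP_iff[OF ne bb] that unfolding m_def by blast
  have mf: "m x = f x" if "x \<in> E" for x
  proof (rule antisym)
    show "m x \<le> f x" unfolding m_def using ne tan[OF that] by (intro cSUP_least) (auto simp: \<tau>_def)
    show "f x \<le> m x" using \<tau>_m[OF that, of x] by (simp add: \<tau>_def)
  qed
  have m_support: "m y + G y \<bullet> (x - y) \<le> m x" if "y \<in> E" for x y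
    using \<tau>_m[OF that, of x] mf[OF that] by (simp add: \<tau>_def)
  have cvx: "convex_on UNIV m"
  proof (rule convex_onI)
    fix t :: real and a b :: 'a assume t: "0 < t" "t < 1"
    have "\<tau> ((1 - t) *\<^sub>R a + t *\<^sub>R b) y \<le> (1 - t) * m a + t * m b" if "y \<in> E" for y
    proof -
      have "\<tau> ((1 - t) *\<^sub>R a + t *\<^sub>R b) y = (1 - t) * \<tau> a y + t * \<tau> b y"
        by (simp add: \<tau>_def inner_simps algebra_simps)
      also have "\<dots> \<le> (1 - t) * m a + t * m b"
        using t \<tau>_m[OF that] by (intro add_mono mult_left_mono) auto
      finally show ?thesis .
    qed
    then show "m ((1 - t) *\<^sub>R a + t *\<^sub>R b) \<le> (1 - t) * m a + t * m b"
      unfolding m_def[of "(1 - t) *\<^sub>R a + t *\<^sub>R b"] using ne by (intro cSUP_least)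
  qed simp
  \<comment> \<open>By \<open>m_support\<close>, \<open>G y\<close> is a subgradient of
    \<open>m\<close>; bounding it takes values of \<open>m\<close> on a ball one unit
    larger.\<close>
  have local_bounds: "\<exists>C>0. (\<forall>x. norm x \<le> R \<longrightarrow> \<bar>m x\<bar> \<le> C) \<and> (\<forall>y\<in>E. norm y \<le> R \<longrightarrow> norm (G y) \<le> C)" for R
  proof -
    from convex_bounded_on_cball[OF cvx, of "R + 1"] obtain C where
      C: "C > 0" "\<And>x. norm x \<le> R + 1 \<Longrightarrow> \<bar>m x\<bar> \<le> C" by metis
    have "norm (G y) \<le> 2 * C" if "y \<in> E" "norm y \<le> R" for y
      using m_support[OF that(1)] by (rule subgradient_norm_le) (use C(2) that(2) in auto)
    moreover have "\<bar>m x\<bar> \<le> 2 * C" if "norm x \<le> R" for x using C(2)[of x] C(1) that by simp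
    ultimately show ?thesis using C(1) by (intro exI[of _ "2 * C"]) simp
  qed
  \<comment> \<open>If \<open>m (y + v)\<close> were too large, some tangent at \<open>z\<close>
    would exceed the tangent at \<open>y\<close> by more than \<open>e * norm v\<close> at
    \<open>y + v\<close>. Then its gap at \<open>y\<close> is below
    \<open>(G z - G y) \<bullet> v - e * norm v\<close>; for small \<open>v\<close>, (iii) gives
    \<open>norm (G z - G y) < e\<close>, and the gap becomes negative, against (i).\<close>
  have small: "\<exists>d>0. \<forall>y\<in>E. \<forall>v. norm y \<le> R \<longrightarrow> norm v \<le> d \<longrightarrow> m (y + v) - f y - G y \<bullet> v \<le> e * norm v"
    if e: "e > 0" for R e
  proof -
    from local_bounds[of R] obtain C where
      C: "C > 0" "\<And>x. norm x \<le> R \<Longrightarrow> \<bar>m x\<bar> \<le> C" "\<And>y. y \<in> E \<Longrightarrow> norm y \<le> R \<Longrightarrow> norm (G y) \<le> C" by blast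
    \<comment> \<open>The tangent at \<open>y\<close> is at least \<open>- (2 * C)\<close> at
      \<open>y + v\<close>, with one \<open>C\<close> for \<open>f y\<close> and one for
      \<open>G y \<bullet> v\<close>. A tangent lying higher inherits this bound, so its slope is
      bounded.\<close>
    from tangent_slopes_bounded[OF ii, of "R + 1" "2 * C"] obtain B where
      B: "\<And>x z. z \<in> E \<Longrightarrow> norm x \<le> R + 1 \<Longrightarrow> - (2 * C) \<le> \<tau> x z \<Longrightarrow> norm (G z) \<le> B" unfolding \<tau>_def by blast
    from cond_iii_uniform[OF i iii e, of "max R B"] obtain \<eta> where \<eta>: "\<eta> > 0"
      "\<And>x z. x \<in> E \<Longrightarrow> z \<in> E \<Longrightarrow> norm x \<le> max R B \<Longrightarrow> norm (G z) \<le> max R B \<Longrightarrow>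
        f x - f z - G z \<bullet> (x - z) \<le> \<eta> \<Longrightarrow> norm (G x - G z) < e" by blast
    \<comment> \<open>Since \<open>norm (G z - G y) \<le> \<bar>B\<bar> + C\<close>, this choice
      makes the gap at most \<open>\<eta>\<close>.\<close>
    define d where "d = min 1 (\<eta> / (\<bar>B\<bar> + C))"
    have d: "d > 0" using \<eta>(1) C(1) by (simp add: d_def add_nonneg_pos)
    have "m (y + v) - f y - G y \<bullet> v \<le> e * norm v" if y: "y \<in> E" "norm y \<le> R" and v: "norm v \<le> d" for y v
    proof (rule ccontr)
      assume neg: "\<not> ?thesis"
      then have "f y + G y \<bullet> v + e * norm v < m (y + v)" by simp
      from near[OF this] obtain z where z: "z \<in> E" "f y + G y \<bullet> v + e * norm v < \<tau> (y + v) z" by blast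
      have v1: "norm v \<le> 1" using v by (simp add: d_def)
      have "\<bar>G y \<bullet> v\<bar> \<le> norm (G y) * norm v" by (rule Cauchy_Schwarz_ineq2)
      also have "\<dots> \<le> C * 1" using C(1) C(3)[OF y] v1 by (intro mult_mono) auto
      finally have "- (2 * C) \<le> f y + G y \<bullet> v" using C(2)[OF y(2)] mf[OF y(1)] by simp
      then have "- (2 * C) \<le> \<tau> (y + v) z"
        using z(2) mult_nonneg_nonneg[of e "norm v"] e by (simp del: mult_nonneg_nonneg)
      moreover have "norm (y + v) \<le> R + 1" using norm_triangle_ineq[of y v] y(2) v1 by linarith
      ultimately have Gz: "norm (G z) \<le> B" using B z(1) by blast
      have gap: "f y - f z - G z \<bullet> (y - z) < (G z - G y) \<bullet> v - e * norm v"
        using z(2) by (simp add: \<tau>_def inner_simps)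
      have "(G z - G y) \<bullet> v \<le> norm (G z - G y) * norm v" by (rule norm_cauchy_schwarz)
      also have "\<dots> \<le> (\<bar>B\<bar> + C) * d"
        using norm_triangle_ineq4[of "G z" "G y"] Gz C(1) C(3)[OF y] v by (intro mult_mono) auto
      also have "\<dots> \<le> (\<bar>B\<bar> + C) * (\<eta> / (\<bar>B\<bar> + C))"
        using C(1) by (intro mult_left_mono) (auto simp: d_def)
      also have "\<dots> = \<eta>" using C(1) by simp
      finally have "f y - f z - G z \<bullet> (y - z) \<le> \<eta>"
        using gap mult_nonneg_nonneg[of e "norm v"] e by (simp del: mult_nonneg_nonneg)
      then have "norm (G y - G z) < e" using \<eta>(2)[OF y(1) z(1)] y(2) Gz by simp
      then have "norm (G z - G y) * norm v \<le> e * norm v"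
        by (intro mult_right_mono) (auto simp: norm_minus_commute)
      then have "f y - f z - G z \<bullet> (y - z) < 0" using gap norm_cauchy_schwarz[of "G z - G y" v] by linarith
      then show False using tan[OF y(1) z(1)] by simp
    qed
    with d show ?thesis by blast
  qed
  have below: "\<exists>C. \<forall>x. norm x \<le> R \<longrightarrow> - C \<le> m x" for R
    using local_bounds[of R] by (meson abs_le_D2 minus_le_iff)
  have bdd: "\<exists>C. \<forall>y\<in>E. \<forall>v. norm y \<le> R \<longrightarrow> norm v \<le> r \<longrightarrow> m (y + v) - f y - G y \<bullet> v \<le> C" for R r
  proof -
    from local_bounds[of "R + \<bar>r\<bar>"] obtain C where C: "C > 0" "\<And>x. norm x \<le> R + \<bar>r\<bar> \<Longrightarrow> \<bar>m x\<bar> \<le> C"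
      "\<And>y. y \<in> E \<Longrightarrow> norm y \<le> R + \<bar>r\<bar> \<Longrightarrow> norm (G y) \<le> C" by blast
    have "m (y + v) - f y - G y \<bullet> v \<le> 2 * C + C * \<bar>r\<bar>" if "y \<in> E" "norm y \<le> R" "norm v \<le> r" for y v
    proof -
      have "norm (y + v) \<le> R + \<bar>r\<bar>" using norm_triangle_ineq[of y v] that by linarith
      then have "m (y + v) \<le> C" using C(2) by fastforce
      moreover have "norm y \<le> R + \<bar>r\<bar>" using that(2) by simp
      then have "- C \<le> f y" "norm (G y) \<le> C" using C(2,3) mf that(1) by fastforce+
      moreover have "\<bar>G y \<bullet> v\<bar> \<le> norm (G y) * norm v" by (rule Cauchy_Schwarz_ineq2)
      moreover have "norm (G y) * norm v \<le> C * \<bar>r\<bar>"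
        using C(1) \<open>norm (G y) \<le> C\<close> that(3) by (intro mult_mono) auto
      ultimately show ?thesis by linarith
    qed
    then show ?thesis by blast
  qed
  from upper_smooth_tangent_envelope[OF ne below bdd small] obtain g where
    g: "upper_smooth g" "\<And>x. m x \<le> g x" "\<And>y. y \<in> E \<Longrightarrow> g y \<le> f y" by blast
  have "f y + G y \<bullet> (x - y) \<le> m x" if "y \<in> E" for x y
    using \<tau>_m[OF that, of x] by (simp add: \<tau>_def)
  then obtain p c C where co: "c > 0" "\<And>x. p \<bullet> x + c * norm x - C \<le> m x"
    using that by (rule max_affine_coercive[OF sp, of f m])
  from upper_smooth_convex_envelope[OF g(1) cvx g(2) co] obtain F where
    F: "convex_on UNIV F" "upper_smooth F" "\<And>x. m x \<le> F x" "\<And>x. F x \<le> g x" by blast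
  have C1: "class_C1 F" using F(1,2) by (rule convex_upper_smooth_imp_class_C1)
  have Ff: "F y = f y" if "y \<in> E" for y using F(3,4)[of y] g(3)[OF that] mf[OF that] by linarith
  have "GDERIV F y :> G y" if y: "y \<in> E" for y
  proof -
    from C1 obtain D where D: "GDERIV F y :> D" unfolding class_C1_def by blast
    have "D = G y"
      using D
    proof (rule touching_support_eq_gradient)
      show "F y + G y \<bullet> (x - y) \<le> F x" for x
        using m_support[OF y, of x] F(3)[of x] mf[OF y] Ff[OF y] by linarith
    qed
    then show ?thesis using D by simp
  qed
  then have "convex_C1_extension E f G F" using F(1) C1 Ff by (simp add: convex_C1_extension_def)
  moreover have "essentially_coercive F"
    using co(1) order_trans[OF co(2) F(3)] by (rule essentially_coerciveI)
  ultimately show ?thesis by (rule that)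
qed

section \<open>Necessity of the conditions\<close>

text \<open>For (ii), a tangent lies below \<open>F\<close>, which is bounded on every ball, so a
  steep one must start far down at 0. For (iii), a tangent nearly touching \<open>F\<close> at a
  point must have nearly the slope of \<open>F\<close> there, uniformly on bounded sets because the
  gradient is uniformly continuous on them.\<close>

lemma convex_C1_extension_conditions:
  fixes E :: "'a::euclidean_space set"
  assumes "convex_C1_extension E f G F"
  shows "cond_i E f G" "cond_ii E f G" "cond_iii E f G"
proof -
  from assms have cvx: "convex_on UNIV F" and "class_C1 F" and Ff: "\<And>x. x \<in> E \<Longrightarrow> F x = f x"
    and FG: "\<And>x. x \<in> E \<Longrightarrow> GDERIV F x :> G x" by (auto simp: convex_C1_extension_def)
  then obtain g where g: "continuous_on UNIV g" "\<And>x. GDERIV F x :> g x" unfolding class_C1_def by blast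
  have sup: "F y + g y \<bullet> (x - y) \<le> F x" for x y using cvx g(2) by (rule convex_GDERIV_support)
  have gG: "g x = G x" if "x \<in> E" for x
    using g(2) by (rule touching_support_eq_gradient) (rule convex_GDERIV_support[OF cvx FG[OF that]])
  have supE: "f y + G y \<bullet> (x - y) \<le> F x" if "y \<in> E" for x y using sup[of y x] Ff gG that by simp
  show "cond_i E f G"
    unfolding cond_i_def
  proof (intro conjI ballI)
    show "continuous_on E G"
      using continuous_on_subset[OF g(1)] gG by (metis continuous_on_cong subset_UNIV)
    show "f y + G y \<bullet> (x - y) \<le> f x" if "x \<in> E" "y \<in> E" for x y
      using supE[OF that(2), of x] Ff[OF that(1)] by simp
  qed
  show "cond_ii E f G"
    unfolding cond_ii_def
  proof (intro allI impI)
    fix x :: "nat \<Rightarrow> 'a" assume x: "\<forall>k. x k \<in> E"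
      and lim: "filterlim (\<lambda>k. norm (G (x k))) at_top sequentially"
    show "filterlim (\<lambda>k. (G (x k) \<bullet> x k - f (x k)) / norm (G (x k))) at_top sequentially"
      unfolding filterlim_at_top
    proof
      fix Z :: real
      \<comment> \<open>The extra unit provides one \<open>norm (G (x k))\<close> to absorb the
        bound \<open>C\<close>.\<close>
      define R where "R = \<bar>Z\<bar> + 1"
      from convex_bounded_on_cball[OF cvx, of R] obtain C where
        C: "C > 0" "\<And>w. norm w \<le> R \<Longrightarrow> \<bar>F w\<bar> \<le> C" by metis
      have "eventually (\<lambda>k. C \<le> norm (G (x k))) sequentially"
        using lim unfolding filterlim_at_top by blast
      then show "eventually (\<lambda>k. Z \<le> (G (x k) \<bullet> x k - f (x k)) / norm (G (x k))) sequentially"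
      proof eventually_elim
        case (elim k)
        then have n: "norm (G (x k)) > 0" using C(1) by linarith
        \<comment> \<open>On the ball of radius \<open>R\<close>, the linear part of the tangent is
          largest at \<open>w\<close>.\<close>
        define w where "w = (R / norm (G (x k))) *\<^sub>R G (x k)"
        have "norm w \<le> R" using n by (simp add: w_def R_def)
        then have "F w \<le> C" using C(2) by fastforce
        moreover have "f (x k) + G (x k) \<bullet> (w - x k) \<le> F w" using supE x by blast
        moreover have "G (x k) \<bullet> w = R * norm (G (x k))"
          using n by (simp add: w_def dot_square_norm power2_eq_square)
        ultimately have "R * norm (G (x k)) - C \<le> G (x k) \<bullet> x k - f (x k)"
          by (simp add: inner_diff_right)
        moreover have "(Z + 1) * norm (G (x k)) \<le> R * norm (G (x k))"
          using n by (intro mult_right_mono) (auto simp: R_def)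
        ultimately have "Z * norm (G (x k)) \<le> G (x k) \<bullet> x k - f (x k)"
          using elim unfolding distrib_right by linarith
        then show ?case using n by (simp add: field_simps)
      qed
    qed
  qed
  show "cond_iii E f G"
    unfolding cond_iii_def
  proof (intro allI impI)
    fix x z :: "nat \<Rightarrow> 'a"
    assume x: "\<forall>k. x k \<in> E" and z: "\<forall>k. z k \<in> E" and "bounded (range x)"
      and lim: "(\<lambda>k. f (x k) - f (z k) - G (z k) \<bullet> (x k - z k)) \<longlonglongrightarrow> 0"
    then obtain R where R: "\<And>k. norm (x k) \<le> R" by (auto simp: bounded_iff)
    show "(\<lambda>k. norm (G (x k) - G (z k))) \<longlonglongrightarrow> 0"
    proof (rule LIMSEQ_I)
      fix e :: real assume e: "e > 0"
      have "uniformly_continuous_on (cball 0 (R + 1)) g"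
        using continuous_on_subset[OF g(1)] by (intro compact_uniformly_continuous) auto
      then obtain d where d: "d > 0" "\<And>u w. norm u \<le> R + 1 \<Longrightarrow> norm w \<le> R + 1 \<Longrightarrow>
          dist w u < d \<Longrightarrow> dist (g w) (g u) < e / 2"
        using e unfolding uniformly_continuous_on_def by (metis half_gt_zero mem_cball_0)
      define r where "r = min 1 (d / 2)"
      have r: "r > 0" "r \<le> 1" "r < d" using d(1) by (auto simp: r_def)
      have "r * e / 2 > 0" using r(1) e by simp
      from LIMSEQ_D[OF lim this] obtain N where
        "\<And>k. k \<ge> N \<Longrightarrow> \<bar>f (x k) - f (z k) - G (z k) \<bullet> (x k - z k)\<bar> < r * e / 2" by auto
      then have N: "\<And>k. k \<ge> N \<Longrightarrow> f (x k) - f (z k) - G (z k) \<bullet> (x k - z k) < r * e / 2"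
        using abs_less_iff by blast
      have "norm (G (x k) - G (z k)) < e" if k: "k \<ge> N" for k
      proof (cases "G (z k) = G (x k)")
        case True
        then show ?thesis using e by simp
      next
        case False
        \<comment> \<open>A step \<open>h\<close> of length \<open>r\<close> along \<open>q\<close>
          shows the slope difference: \<open>F (x k + h)\<close> lies above the tangent at
          \<open>z k\<close> and below \<open>F (x k) + g (x k + h) \<bullet> h\<close>. The gap and
          the oscillation of \<open>g\<close> each cost at most \<open>r * e / 2\<close>, while
          \<open>q \<bullet> h = r * norm q\<close>.\<close>
        define q where "q = G (z k) - G (x k)"
        have q: "norm q > 0" using False by (simp add: q_def)
        define h where "h = (r / norm q) *\<^sub>R q"
        have h: "norm h = r" using q r(1) by (simp add: h_def)
        have "norm (x k + h) \<le> R + 1" using norm_triangle_ineq[of "x k" h] R[of k] h r(2) by linarith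
        moreover have "norm (x k) \<le> R + 1" using R[of k] by linarith
        ultimately have "dist (g (x k + h)) (g (x k)) < e / 2"
          using d(2) h r(3) by (simp add: dist_norm)
        then have "norm (g (x k + h) - g (x k)) * norm h \<le> e / 2 * r"
          unfolding dist_norm h using r(1) by (intro mult_right_mono) auto
        then have "g (x k + h) \<bullet> h - g (x k) \<bullet> h \<le> e / 2 * r"
          using norm_cauchy_schwarz[of "g (x k + h) - g (x k)" h] by (simp add: inner_diff_left)
        moreover have "F (x k + h) - g (x k + h) \<bullet> h \<le> F (x k)" using sup[of "x k + h" "x k"] by simp
        moreover have "f (z k) + G (z k) \<bullet> (x k + h - z k) \<le> F (x k + h)" using supE z by blast
        ultimately have "q \<bullet> h \<le> e / 2 * r + (f (x k) - f (z k) - G (z k) \<bullet> (x k - z k))"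
          using gG x Ff by (simp add: q_def inner_simps)
        also have "\<dots> < e / 2 * r + r * e / 2" using N[OF k] by linarith
        also have "\<dots> = r * e" by simp
        finally have "q \<bullet> h < r * e" .
        moreover have "q \<bullet> h = r * norm q" using q by (simp add: h_def dot_square_norm power2_eq_square)
        ultimately have "norm q < e" using r(1) by simp
        then show ?thesis by (simp add: q_def norm_minus_commute)
      qed
      then show "\<exists>N. \<forall>k\<ge>N. norm (norm (G (x k) - G (z k)) - 0) < e" by auto
    qed
  qed
qed

theorem corollary1p4:
  fixes E :: "(real ^ 'n) set"
    and f :: "real ^ 'n \<Rightarrow> real"
    and G :: "real ^ 'n \<Rightarrow> real ^ 'n"
  assumes "span {G x - G y | x y. x \<in> E \<and> y \<in> E} = UNIV"
  shows "((\<exists>F. convex_C1_extension E f G F) \<longleftrightarrow>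
            cond_i E f G \<and> cond_ii E f G \<and> cond_iii E f G) \<and>
         (cond_i E f G \<and> cond_ii E f G \<and> cond_iii E f G \<longrightarrow>
            (\<exists>F. convex_C1_extension E f G F \<and> essentially_coercive F))"
proof -
  have "\<exists>F. convex_C1_extension E f G F \<and> essentially_coercive F"
    if "cond_i E f G" "cond_ii E f G" "cond_iii E f G"
    using convex_C1_extension_exists[OF assms that] by metis
  moreover have "cond_i E f G \<and> cond_ii E f G \<and> cond_iii E f G"
    if "convex_C1_extension E f G F" for F
    using convex_C1_extension_conditions[OF that] by simp
  ultimately show ?thesis by metis
qed

end
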